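(* Let $M=S^3/I^*$ be the Poincaré dodecahedral space with its spherical metric, and let $F_0$ be the invariant seed eigenfunction on $M$. Then $F_0$ has exactly three critical circles, namely \[ \operatorname{Crit}(F_0)=C_5\sqcup C_3\sqcup C_2, \] where $C_5,C_3,C_2$ are the exceptional Hopf fibers of $M$ of orders $5,3,2$, and $F_0$ is Morse--Bott along each of them.
   Context: $I^*\subset SU(2)$ is the binary icosahedral group (order $120$), acting linearly on the unit sphere $S^3\subset\mathbb C^2$; $M=S^3/I^*$ carries the induced metric $g_0$ of constant curvature $1$. The Hopf map $\mathfrak h:S^3\to S^2$, $\mathfrak h(\alpha,\beta)=(2\operatorname{Re}(\alpha\overline\beta),2\operatorname{Im}(\alpha\overline\beta),|\alpha|^2-|\beta|^2)$, is equivariant for $SU(2)\to SO(3)$, whose kernel is $\{\pm I\}$; the image of $I^*$ is the icosahedral rotation group $A_5\subset SO(3)$. Thus $\mathfrak h$ induces a map $M\to S^2/A_5$. The orbifold $S^2/A_5$ has exactly three singular points, of orders $5,3,2$ (the $A_5$-orbits of the vertices, face centers and edge midpoints of the icosahedron). For $m\in\{5,3,2\}$, the exceptional Hopf fiber $C_m\subset M$ is the circle in $M$ lying over the orbifold point of order $m$. There is a unique line of $A_5$-invariant spherical harmonics of degree $6$ on $S^2$. Let $Y$ be a nonzero real generator. The invariant seed $F_0\in C^\infty(M)$ is the function whose lift to $S^3$ is $Y\circ\mathfrak h$ (the Hopf lift of $Y$); it belongs to the first positive eigenspace of the nonnegative Laplacian of $g_0$, with eigenvalue $168$. A smooth function is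 Morse--Bott along a circle $C$ of critical points if at each point of $C$ the kernel of its Hessian is exactly the tangent line of $C$ (equivalently, the transverse Hessian is nondegenerate). *)

theory Defs
  imports "HOL-Analysis.Analysis"
begin

section \<open>The Hopf map and the double cover of the rotation group\<close>

text \<open>\<open>S\<^sup>3\<close> is the unit sphere of \<open>complex^2\<close>, \<open>S\<^sup>2\<close> the unit sphere of \<open>real^3\<close>.\<close>

abbreviation S3 :: "(complex^2) set" where
  "S3 \<equiv> sphere 0 1"

abbreviation S2 :: "(real^3) set" where
  "S2 \<equiv> sphere 0 1"

definition hopf :: "complex^2 \<Rightarrow> real^3" where
  "hopf p = vector [2 * Re (p$1 * cnj (p$2)), 2 * Im (p$1 * cnj (p$2)),
                    (cmod (p$1))\<^sup>2 - (cmod (p$2))\<^sup>2]"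

definition conj_transpose :: "complex^2^2 \<Rightarrow> complex^2^2" where
  "conj_transpose A = (\<chi> i j. cnj (A$j$i))"

definition SU2 :: "(complex^2^2) set" where
  "SU2 = {A. A ** conj_transpose A = mat 1 \<and> det A = 1}"

definition SO3 :: "(real^3^3) set" where
  "SO3 = {R. orthogonal_matrix R \<and> det R = 1}"

text \<open>\<open>covers A R\<close> says that \<open>R\<close> is the image of \<open>A\<close> under the homomorphism from \<open>SU(2)\<close> to
  \<open>SO(3)\<close> for which the Hopf map is equivariant; \<open>R\<close> is determined by \<open>A\<close> because the Hopf map
  is onto.\<close>

definition covers :: "complex^2^2 \<Rightarrow> real^3^3 \<Rightarrow> bool" where
  "covers A R \<longleftrightarrow> A \<in> SU2 \<and> R \<in> SO3 \<and> (\<forall>p. hopf (A *v p) = R *v hopf p)"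

section \<open>The binary icosahedral group\<close>

definition golden_ratio :: real where
  "golden_ratio = (1 + sqrt 5) / 2"

definition icosahedron_vertices :: "(real^3) set" where
  "icosahedron_vertices =
     (\<Union>s\<in>{1, -1}. \<Union>t\<in>{1, -1}.
        {vector [0, s, t * golden_ratio],
         vector [s, t * golden_ratio, 0],
         vector [t * golden_ratio, 0, s]})"

definition icosahedral_rotations :: "(real^3^3) set" where
  "icosahedral_rotations =
     {R \<in> SO3. (\<lambda>x. R *v x) ` icosahedron_vertices = icosahedron_vertices}"

definition standard_binary_icosahedral :: "(complex^2^2) set" where
  "standard_binary_icosahedral = {A. \<exists>R\<in>icosahedral_rotations. covers A R}"

text \<open>The binary icosahedral subgroup of \<open>SU(2)\<close> is only given up to conjugation, that is, up to the
  position of the icosahedron, so every conjugate is admitted.\<close>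

definition binary_icosahedral :: "(complex^2^2) set \<Rightarrow> bool" where
  "binary_icosahedral I \<longleftrightarrow>
     (\<exists>U\<in>SU2. I = (\<lambda>A. U ** A ** conj_transpose U) ` standard_binary_icosahedral)"

definition rotation_image :: "(complex^2^2) set \<Rightarrow> (real^3^3) set" where
  "rotation_image I = {R. \<exists>A\<in>I. covers A R}"

section \<open>The quotient \<open>M = S\<^sup>3/I\<close> and the exceptional Hopf fibers\<close>

definition orbit :: "(complex^2^2) set \<Rightarrow> complex^2 \<Rightarrow> (complex^2) set" where
  "orbit I p = (\<lambda>A. A *v p) ` I"

definition space_form :: "(complex^2^2) set \<Rightarrow> (complex^2) set set" where
  "space_form I = orbit I ` S3"

text \<open>The order of the point of the orbifold \<open>S\<^sup>2/A\<^sub>5\<close> represented by \<open>x\<close> is the order of the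
  isotropy group of \<open>x\<close>.\<close>

definition orbifold_order :: "(complex^2^2) set \<Rightarrow> real^3 \<Rightarrow> nat" where
  "orbifold_order I x = card {R \<in> rotation_image I. R *v x = x}"

definition exceptional_fiber :: "(complex^2^2) set \<Rightarrow> nat \<Rightarrow> (complex^2) set set" where
  "exceptional_fiber I m = {orbit I p | p. p \<in> S3 \<and> orbifold_order I (hopf p) = m}"

text \<open>A smoothly embedded circle in \<open>M\<close>: the image of a smooth immersed curve which is injective
  modulo its period \<open>L\<close>. The curve is described by a lift \<open>g 0\<close> to \<open>S\<^sup>3\<close>, and \<open>g n\<close> is the \<open>n\<close>-th
  derivative of that lift; the lift itself need not close up after time \<open>L\<close>.\<close>

definition embedded_circle :: "(complex^2^2) set \<Rightarrow> (complex^2) set set \<Rightarrow> bool" where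
  "embedded_circle I C \<longleftrightarrow>
     (\<exists>(g :: nat \<Rightarrow> real \<Rightarrow> complex^2) (L :: real).
        0 < L \<and>
        (\<forall>n t. (g n has_vector_derivative g (Suc n) t) (at t)) \<and>
        (\<forall>t. g 0 t \<in> S3 \<and> g 1 t \<noteq> 0) \<and>
        (\<forall>s t. orbit I (g 0 s) = orbit I (g 0 t) \<longleftrightarrow> (\<exists>k::int. t = s + of_int k * L)) \<and>
        C = range (\<lambda>t. orbit I (g 0 t)))"

section \<open>Critical points and Hessians\<close>

definition second_derivative ::
  "('a::real_normed_vector \<Rightarrow> real) \<Rightarrow> 'a \<Rightarrow> 'a \<Rightarrow> 'a \<Rightarrow> real" where
  "second_derivative f x u v =
     frechet_derivative (\<lambda>y. frechet_derivative f (at y) u) (at x) v"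

definition sphere_tangent_space :: "'a::real_inner \<Rightarrow> 'a set" where
  "sphere_tangent_space p = {v. p \<bullet> v = 0}"

definition radial_extension :: "('a::real_normed_vector \<Rightarrow> real) \<Rightarrow> 'a \<Rightarrow> real" where
  "radial_extension f x = f (x /\<^sub>R norm x)"

text \<open>For \<open>f\<close> smooth on the unit sphere and \<open>u\<close>, \<open>v\<close> tangent to it at \<open>p\<close>, these are the differential
  and the Hessian of the round metric: along the geodesic with initial velocity \<open>v\<close> the second
  derivative of \<open>f\<close> at \<open>p\<close> is that of the radial extension in direction \<open>v\<close>, since the acceleration
  \<open>- (v \<bullet> v) p\<close> is radial and so is annihilated by the differential of the extension.\<close>

definition sphere_differential :: "('a::real_inner \<Rightarrow> real) \<Rightarrow> 'a \<Rightarrow> 'a \<Rightarrow> real" where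
  "sphere_differential f p v = frechet_derivative (radial_extension f) (at p) v"

definition sphere_hessian :: "('a::real_inner \<Rightarrow> real) \<Rightarrow> 'a \<Rightarrow> 'a \<Rightarrow> 'a \<Rightarrow> real" where
  "sphere_hessian f p u v = second_derivative (radial_extension f) p u v"

definition hessian_kernel :: "('a::real_inner \<Rightarrow> real) \<Rightarrow> 'a \<Rightarrow> 'a set" where
  "hessian_kernel f p =
     {u \<in> sphere_tangent_space p. \<forall>v\<in>sphere_tangent_space p. sphere_hessian f p u v = 0}"

text \<open>The projection from \<open>S\<^sup>3\<close> to \<open>M\<close> is a local isometry, so the differential and the Hessian of a
  function on \<open>M\<close> at the orbit of \<open>p\<close> are those of its lift at \<open>p\<close>, on the tangent space of \<open>S\<^sup>3\<close>
  at \<open>p\<close>.\<close>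

definition lift :: "(complex^2^2) set \<Rightarrow> ((complex^2) set \<Rightarrow> real) \<Rightarrow> complex^2 \<Rightarrow> real" where
  "lift I F p = F (orbit I p)"

definition critical_points ::
  "(complex^2^2) set \<Rightarrow> ((complex^2) set \<Rightarrow> real) \<Rightarrow> (complex^2) set set" where
  "critical_points I F =
     {X \<in> space_form I. \<forall>p\<in>X. \<forall>v\<in>sphere_tangent_space p. sphere_differential (lift I F) p v = 0}"

text \<open>The tangent space at the orbit of \<open>p\<close> of a submanifold \<open>C\<close> of \<open>M\<close>, as a subspace of the tangent
  space of \<open>S\<^sup>3\<close> at \<open>p\<close>: the velocities of curves through \<open>p\<close> that project into \<open>C\<close>.\<close>

definition lifted_tangent_space ::
  "(complex^2^2) set \<Rightarrow> (complex^2) set set \<Rightarrow> complex^2 \<Rightarrow> (complex^2) set" where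
  "lifted_tangent_space I C p =
     {v. \<exists>c :: real \<Rightarrow> complex^2. c 0 = p \<and> (\<forall>t. c t \<in> S3 \<and> orbit I (c t) \<in> C) \<and>
           (c has_vector_derivative v) (at 0)}"

definition morse_bott_along ::
  "(complex^2^2) set \<Rightarrow> ((complex^2) set \<Rightarrow> real) \<Rightarrow> (complex^2) set set \<Rightarrow> bool" where
  "morse_bott_along I F C \<longleftrightarrow>
     C \<subseteq> critical_points I F \<and>
     (\<forall>p\<in>S3. orbit I p \<in> C \<longrightarrow> hessian_kernel (lift I F) p = lifted_tangent_space I C p)"

section \<open>The invariant seed\<close>

definition laplacian :: "('a::euclidean_space \<Rightarrow> real) \<Rightarrow> 'a \<Rightarrow> real" where
  "laplacian f x = (\<Sum>b\<in>Basis. second_derivative f x b b)"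

definition spherical_harmonic :: "nat \<Rightarrow> (real^3 \<Rightarrow> real) \<Rightarrow> bool" where
  "spherical_harmonic k Y \<longleftrightarrow>
     (\<exists>P. real_polynomial_function P \<and> (\<forall>c x. P (c *\<^sub>R x) = c ^ k * P x) \<and>
          (\<forall>x. laplacian P x = 0) \<and> (\<forall>x\<in>S2. Y x = P x))"

definition invariant_seed :: "(complex^2^2) set \<Rightarrow> ((complex^2) set \<Rightarrow> real) \<Rightarrow> bool" where
  "invariant_seed I F \<longleftrightarrow>
     (\<exists>Y. spherical_harmonic 6 Y \<and> (\<exists>x\<in>S2. Y x \<noteq> 0) \<and>
          (\<forall>R\<in>rotation_image I. \<forall>x\<in>S2. Y (R *v x) = Y x) \<and>
          (\<forall>p\<in>S3. F (orbit I p) = Y (hopf p)))"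

end

theory Submission
  imports Defs
begin

text \<open>Why the theorem holds. On \<open>S\<^sup>3\<close> the seed is the pullback of the spherical harmonic \<open>Y\<close> under
  the Hopf map. At a unit vector \<open>p\<close> the differential of that map kills the fiber direction \<open>\<i> p\<close> and
  is onto the tangent plane of \<open>S\<^sup>2\<close>. Hence \<open>p\<close> is critical exactly when its image is critical for
  \<open>Y\<close>, and there the kernel of the Hessian is the line of \<open>\<i> p\<close> exactly when \<open>Y\<close> is nondegenerate at
  the image (\<open>critical_iff\<close>, \<open>hessian_kernel_seed\<close>). What remains is a question about \<open>Y\<close> on the
  two-sphere and about the rotation group of the icosahedron.

  The function \<open>Y\<close> is explicit. Among the sextic forms, invariance under the twelve tetrahedral
  rotations leaves four coefficients and invariance under one further half turn leaves two, so in
  standard position \<open>Y\<close> is the restriction of \<open>a \<bar>x\<bar>\<^sup>6 + \<alpha> G\<close> (\<open>invariant_sextic\<close>), where \<open>G\<close> is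
  the product of the six linear forms that vanish on the planes perpendicular to the vertex axes.
  Moreover \<open>\<alpha> \<noteq> 0\<close>, because \<open>\<bar>x\<bar>\<^sup>6\<close> is not harmonic, and so \<open>Y\<close> may be replaced by \<open>G\<close>.

  A point fixed by a nontrivial rotation of the group is critical by symmetry, as the gradient has to
  be fixed as well (\<open>fixed_point_tangentially_critical\<close>). Conversely \<open>G\<close> is a product of three
  linear forms in the squares of the coordinates. The Lagrange equations in these squares can be solved
  by hand, and the solutions are the directions of vertices, face centers and edge midpoints
  (\<open>tangentially_critical_special_direction\<close>). Each of the three kinds is a single orbit, and the
  isotropy groups have orders 5, 3 and 2, so the order determines the kind. By invariance one
  representative of each kind decides nondegeneracy.

  Finally, an element of the binary group that preserves the Hopf fiber of \<open>p\<close> multiplies \<open>p\<close> by a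
  scalar. These scalars form a group which is a double cover of the isotropy group of order \<open>m\<close>, so
  they are the \<open>2m\<close>-th roots of unity (\<open>fiber_rotations\<close>), and \<open>e\<^bsup>it\<^esup> p\<close> projects to a simple closed
  curve of period \<open>\<pi> / m\<close>.\<close>

section \<open>Rotations of space\<close>

abbreviation golden :: real ("\<phi>") where "\<phi> \<equiv> golden_ratio"

(* Keep transpose R *v x as it is, so that it can cancel against R *v x. *)
declare transpose_matrix_vector [simp del]

lemma golden_square: "\<phi> * \<phi> = \<phi> + 1"
proof -
  have "sqrt 5 * sqrt 5 = (5::real)" by simp
  then show ?thesis unfolding golden_ratio_def by (simp add: field_simps)
qed

lemma golden_gt_1: "\<phi> > 1"
  unfolding golden_ratio_def using real_sqrt_less_mono[of 1 5] by simp

lemma matrix_vector_3: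
  "(A *v x) $ i = A$i$1 * x$1 + A$i$2 * x$2 + A$i$3 * x$3" for A :: "real^3^'n"
  by (simp add: matrix_vector_mult_def sum_3)

lemma inner_3: "x \<bullet> y = x$1*y$1 + x$2*y$2 + x$3*y$3" for x y :: "real^3"
  by (simp add: inner_vec_def sum_3)

lemma vec_eq_3: "x = y \<longleftrightarrow> x$1 = y$1 \<and> x$2 = y$2 \<and> x$3 = y$3" for x y :: "'a^3"
  by (simp add: vec_eq_iff forall_3)

lemma SO3_mat_1: "mat 1 \<in> SO3"
  by (simp add: SO3_def orthogonal_matrix_id)

lemma SO3_mult: "R \<in> SO3 \<Longrightarrow> R' \<in> SO3 \<Longrightarrow> R ** R' \<in> SO3"
  by (simp add: SO3_def orthogonal_matrix_mul det_mul)

lemma SO3_transpose: "R \<in> SO3 \<Longrightarrow> transpose R \<in> SO3"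
  by (simp add: SO3_def orthogonal_matrix_transpose det_transpose)

lemma SO3_transpose_mult:
  assumes "R \<in> SO3"
  shows "transpose R ** R = mat 1" "R ** transpose R = mat 1"
    "transpose R *v (R *v x) = x" "R *v (transpose R *v x) = x"
  using assms by (simp_all add: SO3_def orthogonal_matrix_def matrix_vector_mul_assoc)

lemma SO3_inner: "R \<in> SO3 \<Longrightarrow> (R *v x) \<bullet> (R *v y) = x \<bullet> y"
  by (metis dot_lmul_matrix vector_transpose_matrix SO3_transpose_mult(3) inner_commute)

lemma SO3_norm: "R \<in> SO3 \<Longrightarrow> norm (R *v x) = norm x"
  by (simp add: norm_eq_sqrt_inner SO3_inner)

lemma SO3_inj: "R \<in> SO3 \<Longrightarrow> R *v x = R *v y \<longleftrightarrow> x = y"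
  by (metis SO3_transpose_mult(3))

lemma SO3_cross: "R \<in> SO3 \<Longrightarrow> R *v cross3 x y = cross3 (R *v x) (R *v y)"
  using cross_rotation_matrix[of R x y] by (simp add: SO3_def rotation_matrix_def)

text \<open>A rotation preserves cross products, so fixing \<open>x\<close> and \<open>y\<close> it also fixes the third basis vector
  \<open>x \<times> y\<close>. The displacement of any vector is then orthogonal to all three.\<close>

lemma SO3_fixing_two:
  assumes R: "R \<in> SO3" and x: "R *v x = x" and y: "R *v y = y" and xy: "cross3 x y \<noteq> 0"
  shows "R = mat 1"
proof -
  have "R *v z = z" for z
  proof -
    define w where "w = R *v z - z"
    let ?n = "cross3 x y"
    have perp: "u \<bullet> w = 0" if "R *v u = u" for u
      using SO3_inner[OF R, of u z] that by (simp add: w_def inner_diff_right)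
    have "R *v ?n = ?n" using SO3_cross[OF R] x y by simp
    then have "?n \<bullet> w = 0" by (rule perp)
    moreover have "cross3 ?n w = (x \<bullet> w) *\<^sub>R y - (y \<bullet> w) *\<^sub>R x"
      by (simp add: cross3_simps forall_3)
    then have "cross3 ?n w = 0" using perp x y by simp
    ultimately have "w = 0" using xy norm_and_cross_eq_0 by blast
    then show ?thesis by (simp add: w_def)
  qed
  then show ?thesis by (simp add: matrix_eq)
qed

text \<open>This is how rotations are compared below: two of them are equal as soon as they agree on two
  independent vectors.\<close>

lemma SO3_eqI:
  assumes R: "R \<in> SO3" "R' \<in> SO3" and "R *v x = R' *v x" "R *v y = R' *v y" "cross3 x y \<noteq> 0"
  shows "R = R'"
proof -
  have "transpose R' ** R = mat 1"
    by (rule SO3_fixing_two[of _ x y])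
      (use assms in \<open>simp_all add: SO3_mult SO3_transpose SO3_transpose_mult flip: matrix_vector_mul_assoc\<close>)
  then have "R' ** (transpose R' ** R) = R'" by simp
  then show ?thesis by (simp add: matrix_mul_assoc SO3_transpose_mult R)
qed

section \<open>The icosahedral rotation group\<close>

lemma finite_vertices: "finite icosahedron_vertices"
  unfolding icosahedron_vertices_def by (intro finite_UN_I finite.intros)

lemma icosahedral_SO3: "R \<in> icosahedral_rotations \<Longrightarrow> R \<in> SO3"
  by (simp add: icosahedral_rotations_def)

lemma icosahedral_vertex:
  "R \<in> icosahedral_rotations \<Longrightarrow> v \<in> icosahedron_vertices \<Longrightarrow> R *v v \<in> icosahedron_vertices"
  unfolding icosahedral_rotations_def by blast

lemma icosahedral_rotationsI:
  assumes R: "R \<in> SO3" and "\<And>v. v \<in> icosahedron_vertices \<Longrightarrow> R *v v \<in> icosahedron_vertices"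
  shows "R \<in> icosahedral_rotations"
proof -
  have "inj_on (\<lambda>x. R *v x) icosahedron_vertices"
    using SO3_inj[OF R] by (auto intro: inj_onI)
  then have "(\<lambda>x. R *v x) ` icosahedron_vertices = icosahedron_vertices"
    using assms(2) by (intro endo_inj_surj finite_vertices) auto
  then show ?thesis using R by (simp add: icosahedral_rotations_def)
qed

lemma icosahedral_mat_1: "mat 1 \<in> icosahedral_rotations"
  by (simp add: icosahedral_rotations_def SO3_mat_1)

lemma icosahedral_mult:
  "R \<in> icosahedral_rotations \<Longrightarrow> R' \<in> icosahedral_rotations \<Longrightarrow> R ** R' \<in> icosahedral_rotations"
  by (rule icosahedral_rotationsI)
    (auto simp: icosahedral_SO3 SO3_mult icosahedral_vertex simp flip: matrix_vector_mul_assoc)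

lemma icosahedral_transpose:
  assumes "R \<in> icosahedral_rotations"
  shows "transpose R \<in> icosahedral_rotations"
proof (rule icosahedral_rotationsI)
  show "transpose R \<in> SO3" using assms by (simp add: icosahedral_SO3 SO3_transpose)
  fix v assume "v \<in> icosahedron_vertices"
  then obtain w where "w \<in> icosahedron_vertices" "v = R *v w"
    using assms unfolding icosahedral_rotations_def by blast
  then show "transpose R *v v \<in> icosahedron_vertices"
    using assms by (simp add: SO3_transpose_mult icosahedral_SO3)
qed

definition mat3 :: "real \<Rightarrow> real \<Rightarrow> real \<Rightarrow> real \<Rightarrow> real \<Rightarrow> real \<Rightarrow> real \<Rightarrow> real \<Rightarrow> real \<Rightarrow> real^3^3" where
  "mat3 a b c d e f g h i = vector [vector [a, b, c], vector [d, e, f], vector [g, h, i]]"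

lemma mat3_mult_vec [simp]:
  "(mat3 a b c d e f g h i *v x) $ 1 = a * x$1 + b * x$2 + c * x$3"
  "(mat3 a b c d e f g h i *v x) $ 2 = d * x$1 + e * x$2 + f * x$3"
  "(mat3 a b c d e f g h i *v x) $ 3 = g * x$1 + h * x$2 + i * x$3"
  by (simp_all add: matrix_vector_3 mat3_def)

lemma mat3_SO3I:
  assumes "a*a + d*d + g*g = 1" "b*b + e*e + h*h = 1" "c*c + f*f + i*i = 1"
    "a*b + d*e + g*h = 0" "a*c + d*f + g*i = 0" "b*c + e*f + h*i = 0"
    "a*e*i + b*f*g + c*d*h - a*f*h - b*d*i - c*e*g = 1"
  shows "mat3 a b c d e f g h i \<in> SO3"
  using assms
  by (simp add: SO3_def orthogonal_matrix mat3_def det_3 vec_eq_3 matrix_matrix_mult_def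
      transpose_def sum_3 mat_def mult.commute)

text \<open>A cyclic permutation of the coordinates and the half turns about the axes generate the twelve
  tetrahedral rotations. The remaining generator is the half turn about the edge axis through
  \<open>(\<phi>, 1, \<phi> - 1)\<close>, where \<open>\<phi> - 1 = 1 / \<phi>\<close>.\<close>

definition "cycle = mat3 0 1 0  0 0 1  1 0 0"
definition "flip1 = mat3 1 0 0  0 (-1) 0  0 0 (-1)"
definition "flip2 = mat3 (-1) 0 0  0 1 0  0 0 (-1)"
definition "flip3 = mat3 (-1) 0 0  0 (-1) 0  0 0 1"
definition "half_turn =
  mat3 ((\<phi> - 1)/2) (\<phi>/2) (1/2)  (\<phi>/2) (-1/2) ((\<phi> - 1)/2)  (1/2) ((\<phi> - 1)/2) (-\<phi>/2)"

lemma minus_vector_3: "- vector [a, b, c] = (vector [- a, - b, - c] :: real^3)"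
  by (simp add: vec_eq_3)

text \<open>One vertex from each antipodal pair, which halves the checks needed for membership in the group.\<close>

definition half_vertices :: "(real^3) set" where
  "half_vertices = {vector [0, 1, \<phi>], vector [0, 1, -\<phi>], vector [1, \<phi>, 0], vector [1, -\<phi>, 0],
      vector [\<phi>, 0, 1], vector [-\<phi>, 0, 1]}"

lemma icosahedron_vertices_eq: "icosahedron_vertices = half_vertices \<union> uminus ` half_vertices"
  unfolding icosahedron_vertices_def half_vertices_def
  by (intro equalityI) (simp_all add: minus_vector_3)

lemma vertices_minus: "v \<in> icosahedron_vertices \<Longrightarrow> - v \<in> icosahedron_vertices"
  unfolding icosahedron_vertices_eq by auto

lemma icosahedral_rotationsI_half:
  assumes R: "R \<in> SO3" and V: "\<And>v. v \<in> half_vertices \<Longrightarrow> R *v v \<in> icosahedron_vertices"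
  shows "R \<in> icosahedral_rotations"
proof (rule icosahedral_rotationsI[OF R])
  fix v assume v: "v \<in> icosahedron_vertices"
  then consider "v \<in> half_vertices" | w where "w \<in> half_vertices" "v = - w"
    unfolding icosahedron_vertices_eq by blast
  then show "R *v v \<in> icosahedron_vertices"
  proof cases
    case 1 then show ?thesis by (rule V)
  next
    case 2
    then have "- (R *v w) \<in> icosahedron_vertices" by (intro vertices_minus V)
    then show ?thesis using 2 by (simp add: vec.neg)
  qed
qed

lemma half_turn_components [simp]:
  "(half_turn *v x) $ 1 = ((\<phi> - 1) * x$1 + \<phi> * x$2 + x$3) / 2"
  "(half_turn *v x) $ 2 = (\<phi> * x$1 - x$2 + (\<phi> - 1) * x$3) / 2"
  "(half_turn *v x) $ 3 = (x$1 + (\<phi> - 1) * x$2 - \<phi> * x$3) / 2"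
  by (simp_all add: half_turn_def field_simps)

lemma rotation_of_half_vertices:
  assumes "R \<in> SO3"
    and "R *v vector [0, 1, \<phi>] \<in> icosahedron_vertices" "R *v vector [0, 1, -\<phi>] \<in> icosahedron_vertices"
      "R *v vector [1, \<phi>, 0] \<in> icosahedron_vertices" "R *v vector [1, -\<phi>, 0] \<in> icosahedron_vertices"
      "R *v vector [\<phi>, 0, 1] \<in> icosahedron_vertices" "R *v vector [-\<phi>, 0, 1] \<in> icosahedron_vertices"
  shows "R \<in> icosahedral_rotations"
  using assms(1)
proof (rule icosahedral_rotationsI_half)
  fix v assume "v \<in> half_vertices"
  then show "R *v v \<in> icosahedron_vertices"
    unfolding half_vertices_def insert_iff using assms(2-) by (elim disjE) simp_all
qed

lemma tetrahedral_rotations: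
  "cycle \<in> icosahedral_rotations" "flip1 \<in> icosahedral_rotations"
  "flip2 \<in> icosahedral_rotations" "flip3 \<in> icosahedral_rotations"
  unfolding cycle_def flip1_def flip2_def flip3_def
  by (rule rotation_of_half_vertices, rule mat3_SO3I; simp add: icosahedron_vertices_def vec_eq_3)+

lemma half_turn_SO3: "half_turn \<in> SO3"
proof -
  have s: "\<phi> * \<phi> = \<phi> + 1" by (rule golden_square)
  have s3: "\<phi> * (\<phi> * \<phi>) = 2 * \<phi> + 1" using s by algebra
  show ?thesis unfolding half_turn_def
    by (rule mat3_SO3I) (use s s3 in \<open>simp_all add: field_simps\<close>)
qed

lemma half_turn: "half_turn \<in> icosahedral_rotations"
  using half_turn_SO3
  by (rule rotation_of_half_vertices) (simp_all add: icosahedron_vertices_def vec_eq_3 golden_square algebra_simps)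

lemma golden_pos [simp]: "0 < \<phi>" "\<phi> \<noteq> 0"
  using golden_gt_1 by auto

lemma tetrahedral_components [simp]:
  "(cycle *v x) $ 1 = x$2" "(cycle *v x) $ 2 = x$3" "(cycle *v x) $ 3 = x$1"
  "(flip1 *v x) $ 1 = x$1" "(flip1 *v x) $ 2 = - x$2" "(flip1 *v x) $ 3 = - x$3"
  "(flip2 *v x) $ 1 = - x$1" "(flip2 *v x) $ 2 = x$2" "(flip2 *v x) $ 3 = - x$3"
  "(flip3 *v x) $ 1 = - x$1" "(flip3 *v x) $ 2 = - x$2" "(flip3 *v x) $ 3 = x$3"
  by (simp_all add: cycle_def flip1_def flip2_def flip3_def)

text \<open>A rotation is determined by the images of two independent vertices.\<close>

lemma finite_icosahedral_rotations: "finite icosahedral_rotations"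
proof (rule finite_imageD)
  let ?v = "vector [0, 1, \<phi>] :: real^3" and ?w = "vector [1, \<phi>, 0] :: real^3"
  let ?f = "\<lambda>R :: real^3^3. (R *v ?v, R *v ?w)"
  have vw: "?v \<in> icosahedron_vertices" "?w \<in> icosahedron_vertices"
    by (simp_all add: icosahedron_vertices_def)
  have "?f ` icosahedral_rotations \<subseteq> icosahedron_vertices \<times> icosahedron_vertices"
    using vw by (auto intro: icosahedral_vertex)
  then show "finite (?f ` icosahedral_rotations)"
    by (rule finite_subset) (simp add: finite_vertices)
  have "cross3 ?v ?w \<noteq> 0" by (simp add: cross3_def vec_eq_3)
  then show "inj_on ?f icosahedral_rotations"
    by (intro inj_onI) (auto intro: SO3_eqI icosahedral_SO3)
qed

section \<open>Isotropy groups and orbits of directions\<close>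

definition stabilizer :: "real^3 \<Rightarrow> (real^3^3) set" where
  "stabilizer x = {R \<in> icosahedral_rotations. R *v x = x}"

lemma stabilizer_mult: "R \<in> stabilizer x \<Longrightarrow> R' \<in> stabilizer x \<Longrightarrow> R ** R' \<in> stabilizer x"
  by (simp add: stabilizer_def icosahedral_mult flip: matrix_vector_mul_assoc)

lemma mat_1_in_stabilizer: "mat 1 \<in> stabilizer x"
  by (simp add: stabilizer_def icosahedral_mat_1)

text \<open>A rotation about \<open>x\<close> is determined by the image of one vertex \<open>v\<close> off the axis, and that image is
  a vertex at the same height over \<open>x\<close>. So the isotropy group is as large as the set of these
  vertices, provided that all of them are reached.\<close>

lemma card_stabilizer:
  assumes xv: "cross3 x v \<noteq> 0" and v: "v \<in> icosahedron_vertices"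
    and W: "\<And>w. w \<in> icosahedron_vertices \<Longrightarrow> w \<bullet> x = v \<bullet> x \<Longrightarrow> w \<in> W"
    and R: "\<And>w. w \<in> W \<Longrightarrow> \<exists>R\<in>stabilizer x. R *v v = w"
  shows "card (stabilizer x) = card W"
proof (rule bij_betw_same_card[of "\<lambda>R. R *v v"], rule bij_betw_imageI)
  show "inj_on (\<lambda>R. R *v v) (stabilizer x)"
    using xv by (intro inj_onI SO3_eqI[of _ _ x v]) (auto simp: stabilizer_def icosahedral_SO3)
  show "(\<lambda>R. R *v v) ` stabilizer x = W"
  proof (intro equalityI subsetI)
    fix w assume "w \<in> (\<lambda>R. R *v v) ` stabilizer x"
    then obtain R where S: "R \<in> stabilizer x" "w = R *v v" by blast
    then have "w \<bullet> x = v \<bullet> x"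
      using SO3_inner[of R v x] by (simp add: stabilizer_def icosahedral_SO3)
    then show "w \<in> W" using S v by (intro W) (simp_all add: stabilizer_def icosahedral_vertex)
  qed (use R in blast)
qed

definition edge_direction :: "real^3" where "edge_direction = vector [1, 0, 0]"
definition face_direction :: "real^3" where "face_direction = vector [1, 1, 1]"
definition vertex_direction :: "real^3" where "vertex_direction = vector [0, 1, \<phi>]"

lemmas direction_defs = edge_direction_def face_direction_def vertex_direction_def

lemma card_stabilizer_edge: "card (stabilizer edge_direction) = 2"
proof -
  let ?v = "vector [\<phi>, 0, 1] :: real^3" and ?w = "vector [\<phi>, 0, -1] :: real^3"
  have "card (stabilizer edge_direction) = card {?v, ?w}"
  proof (rule card_stabilizer[of _ ?v])
    show "w \<in> {?v, ?w}" if "w \<in> icosahedron_vertices" "w \<bullet> edge_direction = ?v \<bullet> edge_direction" for w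
      using that golden_gt_1 unfolding icosahedron_vertices_def
      by (auto simp: inner_3 edge_direction_def)
    show "\<exists>R\<in>stabilizer edge_direction. R *v ?v = w" if "w \<in> {?v, ?w}" for w
    proof -
      have "flip1 \<in> stabilizer edge_direction" "flip1 *v ?v = ?w"
        by (simp_all add: stabilizer_def tetrahedral_rotations edge_direction_def vec_eq_3)
      then show ?thesis using that mat_1_in_stabilizer matrix_vector_mul_lid by blast
    qed
  qed (simp_all add: edge_direction_def icosahedron_vertices_def cross3_def vec_eq_3)
  also have "\<dots> = 2" by (simp add: vec_eq_3)
  finally show ?thesis .
qed

lemma card_stabilizer_face: "card (stabilizer face_direction) = 3"
proof -
  let ?u = "vector [0, 1, \<phi>] :: real^3" and ?v = "vector [1, \<phi>, 0] :: real^3"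
    and ?w = "vector [\<phi>, 0, 1] :: real^3"
  have "card (stabilizer face_direction) = card {?u, ?v, ?w}"
  proof (rule card_stabilizer[of _ ?u])
    show "w \<in> {?u, ?v, ?w}" if "w \<in> icosahedron_vertices" "w \<bullet> face_direction = ?u \<bullet> face_direction" for w
      using that golden_gt_1 unfolding icosahedron_vertices_def
      by (auto simp: inner_3 face_direction_def)
    show "\<exists>R\<in>stabilizer face_direction. R *v ?u = w" if "w \<in> {?u, ?v, ?w}" for w
    proof -
      have "cycle \<in> stabilizer face_direction" "cycle *v ?u = ?v" "cycle *v ?v = ?w"
        by (simp_all add: stabilizer_def tetrahedral_rotations face_direction_def vec_eq_3)
      then show ?thesis
        using that mat_1_in_stabilizer stabilizer_mult[of "cycle" _ "cycle"]
        by (metis insertE matrix_vector_mul_assoc matrix_vector_mul_lid singletonD)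
    qed
  qed (simp_all add: face_direction_def icosahedron_vertices_def cross3_def vec_eq_3)
  also have "\<dots> = 3" by (simp add: vec_eq_3)
  finally show ?thesis .
qed

text \<open>The five neighbors of a vertex lie at the same height, and the rotation \<open>r\<close> of order 5 runs through
  them in cyclic order.\<close>

lemma card_stabilizer_vertex: "card (stabilizer vertex_direction) = 5"
proof -
  define r where "r = flip3 ** half_turn ** flip2"
  let ?w0 = "vector [0, -1, \<phi>] :: real^3" and ?w1 = "vector [\<phi>, 0, 1] :: real^3"
    and ?w2 = "vector [1, \<phi>, 0] :: real^3" and ?w3 = "vector [-1, \<phi>, 0] :: real^3"
    and ?w4 = "vector [-\<phi>, 0, 1] :: real^3"
  let ?W = "{?w0, ?w1, ?w2, ?w3, ?w4}"
  have r: "(r *v x) = flip3 *v (half_turn *v (flip2 *v x))" for x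
    by (simp add: r_def flip: matrix_vector_mul_assoc)
  have rs: "r \<in> stabilizer vertex_direction"
    by (simp add: stabilizer_def r_def tetrahedral_rotations half_turn icosahedral_mult)
      (simp add: vertex_direction_def r[unfolded r_def] vec_eq_3 golden_square algebra_simps)
  have rw: "r *v ?w0 = ?w1" "r *v ?w1 = ?w2" "r *v ?w2 = ?w3" "r *v ?w3 = ?w4"
    by (simp_all add: r vec_eq_3 golden_square algebra_simps)
  have "card (stabilizer vertex_direction) = card ?W"
  proof (rule card_stabilizer[of _ ?w0])
    show "w \<in> ?W" if "w \<in> icosahedron_vertices" "w \<bullet> vertex_direction = ?w0 \<bullet> vertex_direction" for w
      using that golden_gt_1 unfolding icosahedron_vertices_def
      by (auto simp: inner_3 vertex_direction_def golden_square)
    have step: "\<exists>R\<in>stabilizer vertex_direction. R *v ?w0 = r *v w"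
      if "\<exists>R\<in>stabilizer vertex_direction. R *v ?w0 = w" for w
      using that rs stabilizer_mult by (metis matrix_vector_mul_assoc)
    have "\<exists>R\<in>stabilizer vertex_direction. R *v ?w0 = ?w0"
      using mat_1_in_stabilizer by force
    note s0 = this and s1 = step[OF this, unfolded rw]
    note s2 = step[OF s1, unfolded rw]
    note s3 = step[OF s2, unfolded rw]
    note s4 = step[OF s3, unfolded rw]
    show "\<exists>R\<in>stabilizer vertex_direction. R *v ?w0 = w" if "w \<in> ?W" for w
      using that s0 s1 s2 s3 s4 unfolding insert_iff by (elim disjE) simp_all
  qed (simp_all add: vertex_direction_def icosahedron_vertices_def cross3_def vec_eq_3)
  also have "\<dots> = 5" using golden_gt_1 by (simp add: vec_eq_3)
  finally show ?thesis .
qed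

text \<open>Isotropy groups do not change under scaling, so points of the sphere can be compared with
  unnormalized representatives, up to a rotation of the group and a nonzero factor.\<close>

definition ico_proportional :: "real^3 \<Rightarrow> real^3 \<Rightarrow> bool" where
  "ico_proportional x y \<longleftrightarrow> (\<exists>R\<in>icosahedral_rotations. \<exists>c. c \<noteq> 0 \<and> R *v x = c *\<^sub>R y)"

lemma ico_proportionalI:
  "R \<in> icosahedral_rotations \<Longrightarrow> c \<noteq> 0 \<Longrightarrow> R *v x = c *\<^sub>R y \<Longrightarrow> ico_proportional x y"
  by (auto simp: ico_proportional_def)

lemma ico_proportional_trans:
  assumes "ico_proportional x y" "ico_proportional y z"
  shows "ico_proportional x z"
proof -
  obtain R c R' c' where "R \<in> icosahedral_rotations" "c \<noteq> 0" "R *v x = c *\<^sub>R y"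
    "R' \<in> icosahedral_rotations" "c' \<noteq> 0" "R' *v y = c' *\<^sub>R z"
    using assms by (auto simp: ico_proportional_def)
  then show ?thesis
    by (intro ico_proportionalI[of "R' ** R" "c * c'"])
      (simp_all add: icosahedral_mult matrix_vector_mult_scaleR flip: matrix_vector_mul_assoc)
qed

text \<open>Isotropy groups of points in one orbit are conjugate.\<close>

lemma card_stabilizer_proportional:
  assumes "ico_proportional x y"
  shows "card (stabilizer x) = card (stabilizer y)"
proof -
  obtain R c where R: "R \<in> icosahedral_rotations" and c: "c \<noteq> 0" "R *v x = c *\<^sub>R y"
    using assms by (auto simp: ico_proportional_def)
  note RT = SO3_transpose_mult[OF icosahedral_SO3[OF R]]
  have y: "y = (1/c) *\<^sub>R (R *v x)" using c by simp
  have x: "x = c *\<^sub>R (transpose R *v y)"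
    using RT(3)[of x] c by (simp add: matrix_vector_mult_scaleR)
  show ?thesis
  proof (rule bij_betw_same_card[of "\<lambda>A. R ** A ** transpose R"],
      rule bij_betw_byWitness[where f' = "\<lambda>A. transpose R ** A ** R"])
    show "\<forall>A\<in>stabilizer x. transpose R ** (R ** A ** transpose R) ** R = A"
      "\<forall>A\<in>stabilizer y. R ** (transpose R ** A ** R) ** transpose R = A"
      by (metis RT(1,2) matrix_mul_assoc matrix_mul_lid matrix_mul_rid)+
    show "(\<lambda>A. R ** A ** transpose R) ` stabilizer x \<subseteq> stabilizer y"
      using R c(1) by (auto simp: stabilizer_def icosahedral_mult icosahedral_transpose y
          matrix_vector_mult_scaleR RT simp flip: matrix_vector_mul_assoc)
    show "(\<lambda>A. transpose R ** A ** R) ` stabilizer y \<subseteq> stabilizer x"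
      using R c(1) by (auto simp: stabilizer_def icosahedral_mult icosahedral_transpose x
          matrix_vector_mult_scaleR RT simp flip: matrix_vector_mul_assoc)
  qed
qed

lemma half_turn_face: "half_turn *v face_direction = vector [\<phi>, \<phi> - 1, 0]"
  by (simp add: face_direction_def vec_eq_3 field_simps)

text \<open>Factors in \<^const>\<open>ico_proportional\<close> may be negative. This lemma removes the sign, although
  \<open>- 1\<close> itself is not a rotation.\<close>

lemma antipodal_direction:
  assumes "e \<in> {edge_direction, face_direction, vertex_direction}"
  shows "\<exists>R\<in>icosahedral_rotations. R *v e = - e"
proof -
  have "flip2 *v edge_direction = - edge_direction" "flip1 *v vertex_direction = - vertex_direction"
    by (simp_all add: direction_defs vec_eq_3)
  moreover have "(half_turn ** flip3 ** half_turn) *v face_direction = - face_direction"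
    by (simp add: half_turn_face flip: matrix_vector_mul_assoc)
      (simp add: direction_defs vec_eq_3 golden_square algebra_simps)
  ultimately show ?thesis
    using assms tetrahedral_rotations half_turn icosahedral_mult by blast
qed

lemma proportional_unit_vectors:
  assumes e: "e \<in> {edge_direction, face_direction, vertex_direction}"
    and x: "ico_proportional x e" and y: "ico_proportional y e" and n: "norm x = norm y"
  shows "\<exists>R\<in>icosahedral_rotations. y = R *v x"
proof -
  obtain R c R' c' where R: "R \<in> icosahedral_rotations" "R *v x = c *\<^sub>R e"
    and R': "R' \<in> icosahedral_rotations" "R' *v y = c' *\<^sub>R e"
    using x y by (auto simp: ico_proportional_def)
  obtain N where N: "N \<in> icosahedral_rotations" "N *v e = - e"
    using antipodal_direction[OF e] by blast
  have "e \<noteq> 0" using e by (auto simp: direction_defs vec_eq_3)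
  moreover have "norm (c *\<^sub>R e) = norm (c' *\<^sub>R e)"
    using R R' n by (metis SO3_norm icosahedral_SO3)
  ultimately have "c' = c \<or> c' = - c" by auto
  then have "\<exists>M\<in>icosahedral_rotations. R' *v y = M *v (R *v x)"
  proof
    assume "c' = c"
    then show ?thesis using R R' icosahedral_mat_1 by force
  next
    assume "c' = - c"
    then have "R' *v y = N *v (R *v x)" using R R' N by (simp add: matrix_vector_mult_scaleR)
    then show ?thesis using N by blast
  qed
  then obtain M where "M \<in> icosahedral_rotations" "R' *v y = M *v (R *v x)" by blast
  then have "y = (transpose R' ** M ** R) *v x"
    using SO3_transpose_mult(3)[of R' y] R'(1)
    by (simp add: icosahedral_SO3 flip: matrix_vector_mul_assoc)
  moreover have "transpose R' ** M ** R \<in> icosahedral_rotations"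
    using R(1) R'(1) \<open>M \<in> _\<close> by (intro icosahedral_mult icosahedral_transpose)
  ultimately show ?thesis by blast
qed

section \<open>Invariant sextic forms\<close>

text \<open>Polynomials in three variables are lists of terms; a term \<open>(c, i, j, k)\<close> has coefficient \<open>c\<close> and
  exponents \<open>i\<close>, \<open>j\<close>, \<open>k\<close>.\<close>

definition monomial :: "real \<times> nat \<times> nat \<times> nat \<Rightarrow> real^3 \<Rightarrow> real" where
  "monomial m x = (case m of (c, i, j, k) \<Rightarrow> c * x$1 ^ i * x$2 ^ j * x$3 ^ k)"

definition total_degree :: "real \<times> nat \<times> nat \<times> nat \<Rightarrow> nat" where
  "total_degree m = (case m of (c, i, j, k) \<Rightarrow> i + j + k)"

definition monomial_sum :: "(real \<times> nat \<times> nat \<times> nat) list \<Rightarrow> real^3 \<Rightarrow> real" where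
  "monomial_sum ms x = (\<Sum>m\<leftarrow>ms. monomial m x)"

lemma monomial_sum_simps [simp]:
  "monomial_sum [] x = 0" "monomial_sum (m # ms) x = monomial m x + monomial_sum ms x"
  "monomial_sum (ms @ ns) x = monomial_sum ms x + monomial_sum ns x"
  by (simp_all add: monomial_sum_def)

lemma monomial_times_monomial_sum: "\<exists>ns. \<forall>x. monomial m x * monomial_sum ms x = monomial_sum ns x"
proof (induction ms)
  case Nil
  show ?case by (rule exI[of _ "[]"]) simp
next
  case (Cons m' ms)
  then obtain ns where ns: "\<And>x. monomial m x * monomial_sum ms x = monomial_sum ns x" by blast
  obtain c i j k where m: "m = (c, i, j, k)" by (cases m)
  obtain c' i' j' k' where m': "m' = (c', i', j', k')" by (cases m')
  then show ?case
    by (intro exI[of _ "(c * c', i + i', j + j', k + k') # ns"])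
      (simp add: distrib_left ns, simp add: m m' monomial_def power_add)
qed

lemma monomial_sum_times: "\<exists>ns'. \<forall>x. monomial_sum ms x * monomial_sum ns x = monomial_sum ns' x"
proof (induction ms)
  case Nil
  show ?case by (rule exI[of _ "[]"]) simp
next
  case (Cons m ms)
  then obtain ns' where "\<And>x. monomial_sum ms x * monomial_sum ns x = monomial_sum ns' x" by blast
  moreover obtain ns'' where "\<And>x. monomial m x * monomial_sum ns x = monomial_sum ns'' x"
    using monomial_times_monomial_sum by blast
  ultimately show ?case
    by (intro exI[of _ "ns'' @ ns'"]) (simp add: distrib_right)
qed

lemma real_polynomial_function_monomial_sum:
  fixes P :: "real^3 \<Rightarrow> real"
  assumes "real_polynomial_function P"
  shows "\<exists>ms. \<forall>x. P x = monomial_sum ms x"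
  using assms
proof induction
  case (linear f)
  interpret bounded_linear f by fact
  define a b c where abc: "a = f (axis 1 1)" "b = f (axis 2 1)" "c = f (axis 3 1)"
  have f: "f x = a * x$1 + b * x$2 + c * x$3" for x
  proof -
    have "x = x$1 *\<^sub>R axis 1 1 + x$2 *\<^sub>R axis 2 1 + x$3 *\<^sub>R axis 3 1"
      by (simp add: vec_eq_3 axis_def)
    then have "f x = f (x$1 *\<^sub>R axis 1 1 + x$2 *\<^sub>R axis 2 1 + x$3 *\<^sub>R axis 3 1)" by (rule arg_cong)
    also have "\<dots> = a * x$1 + b * x$2 + c * x$3"
      by (simp only: add scaleR) (simp add: abc mult.commute)
    finally show ?thesis .
  qed
  show ?case
    by (intro exI[of _ "[(a, 1, 0, 0), (b, 0, 1, 0), (c, 0, 0, 1)]"]) (simp add: f monomial_def)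
next
  case (const c)
  show ?case by (rule exI[of _ "[(c, 0, 0, 0)]"]) (simp add: monomial_def)
next
  case (add f g)
  then obtain ms ns where "\<And>x. f x = monomial_sum ms x" "\<And>x. g x = monomial_sum ns x" by blast
  then show ?case by (intro exI[of _ "ms @ ns"]) simp
next
  case (mult f g)
  then obtain ms ns where "\<And>x. f x = monomial_sum ms x" "\<And>x. g x = monomial_sum ns x" by blast
  then show ?case using monomial_sum_times[of ms ns] by simp
qed

text \<open>For fixed \<open>x\<close> both \<open>P (t x)\<close> and \<open>t\<^sup>n P x\<close> are polynomials in \<open>t\<close>; compare the coefficients of
  \<open>t\<^sup>n\<close>.\<close>

lemma homogeneous_monomial_sum:
  assumes hom: "\<And>t x. monomial_sum ms (t *\<^sub>R x) = t ^ n * monomial_sum ms x"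
  shows "monomial_sum ms x = monomial_sum (filter (\<lambda>m. total_degree m = n) ms) x"
proof -
  define q where "q ms = (\<Sum>m\<leftarrow>ms. monom (monomial m x) (total_degree m))" for ms
  have q: "poly (q ms) t = monomial_sum ms (t *\<^sub>R x)" for ms t
    by (induction ms)
      (auto simp: q_def poly_monom monomial_def total_degree_def power_mult_distrib power_add algebra_simps)
  have c: "coeff (q ms) n = monomial_sum (filter (\<lambda>m. total_degree m = n) ms) x" for ms
    by (induction ms) (auto simp: q_def)
  have "poly (q ms) = poly (monom (monomial_sum ms x) n)"
    by (rule ext) (simp add: q hom poly_monom)
  then have "q ms = monom (monomial_sum ms x) n" by (simp add: poly_eq_poly_eq_iff)
  then show ?thesis using c[of ms] by simp
qed

definition tetrahedral_sum :: "(real^3 \<Rightarrow> real) \<Rightarrow> real^3 \<Rightarrow> real" where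
  "tetrahedral_sum P x = (\<Sum>y\<leftarrow>[x, cycle *v x, cycle *v (cycle *v x)].
      P y + P (flip1 *v y) + P (flip2 *v y) + P (flip3 *v y))"

text \<open>The general sextic form that is invariant under the tetrahedral rotations.\<close>

definition tetrahedral_sextic :: "real \<Rightarrow> real \<Rightarrow> real \<Rightarrow> real \<Rightarrow> real^3 \<Rightarrow> real" where
  "tetrahedral_sextic a b c d x =
     a * (x$1^6 + x$2^6 + x$3^6) + b * (x$1^4 * x$2^2 + x$2^4 * x$3^2 + x$3^4 * x$1^2)
     + c * (x$1^2 * x$2^4 + x$2^2 * x$3^4 + x$3^2 * x$1^4) + d * (x$1^2 * x$2^2 * x$3^2)"

text \<open>Summing over the three half turns kills a monomial unless all exponents are even. The ten even
  exponents of degree six fall into four orbits of the cyclic permutation.\<close>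

lemma tetrahedral_sum_monomial:
  assumes "i + j + k = 6"
  shows "\<exists>a b c d. \<forall>x. tetrahedral_sum (monomial (r, i, j, k)) x = tetrahedral_sextic a b c d x"
proof (cases "even i \<and> even j")
  case True
  then obtain p q where pq: "i = 2 * p" "j = 2 * q" by (auto elim!: evenE)
  have k: "k = 2 * (3 - p - q)" "p + q \<le> 3" using assms pq by auto
  then have "p \<in> {0,1,2,3}" "q \<in> {0,1,2,3}" by auto
  then consider "(p, q) \<in> {(3,0), (0,3), (0,0)}" | "(p, q) \<in> {(2,1), (0,2), (1,0)}"
    | "(p, q) \<in> {(1,2), (0,1), (2,0)}" | "(p, q) = (1, 1)"
    using k(2) by auto
  then show ?thesis
  proof cases
    case 1
    then have "tetrahedral_sum (monomial (r, i, j, k)) x = tetrahedral_sextic (4 * r) 0 0 0 x" for x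
      by (auto simp: pq k tetrahedral_sum_def tetrahedral_sextic_def monomial_def power2_eq_square algebra_simps)
    then show ?thesis by blast
  next
    case 2
    then have "tetrahedral_sum (monomial (r, i, j, k)) x = tetrahedral_sextic 0 (4 * r) 0 0 x" for x
      by (auto simp: pq k tetrahedral_sum_def tetrahedral_sextic_def monomial_def power2_eq_square algebra_simps)
    then show ?thesis by blast
  next
    case 3
    then have "tetrahedral_sum (monomial (r, i, j, k)) x = tetrahedral_sextic 0 0 (4 * r) 0 x" for x
      by (auto simp: pq k tetrahedral_sum_def tetrahedral_sextic_def monomial_def power2_eq_square algebra_simps)
    then show ?thesis by blast
  next
    case 4
    then have "tetrahedral_sum (monomial (r, i, j, k)) x = tetrahedral_sextic 0 0 0 (12 * r) x" for x
      by (auto simp: pq k tetrahedral_sum_def tetrahedral_sextic_def monomial_def power2_eq_square algebra_simps)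
    then show ?thesis by blast
  qed
next
  case False
  have "even i = (even j = even k)"
    using arg_cong[OF assms, of even] by auto
  with False consider "even i" "odd j" "odd k" | "odd i" "even j" "odd k" | "odd i" "odd j" "even k"
    by auto
  then have "tetrahedral_sum (monomial (r, i, j, k)) x = 0" for x
    by cases (simp_all add: tetrahedral_sum_def monomial_def)
  then show ?thesis
    by (intro exI[of _ 0]) (simp add: tetrahedral_sextic_def)
qed

lemma tetrahedral_sum_monomial_sum:
  assumes "\<forall>m\<in>set ms. total_degree m = 6"
  shows "\<exists>a b c d. \<forall>x. tetrahedral_sum (monomial_sum ms) x = tetrahedral_sextic a b c d x"
  using assms
proof (induction ms)
  case Nil
  show ?case by (intro exI[of _ 0]) (simp add: tetrahedral_sum_def tetrahedral_sextic_def)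
next
  case (Cons m ms)
  obtain r i j k where m: "m = (r, i, j, k)" by (cases m)
  obtain a b c d where *: "\<And>x. tetrahedral_sum (monomial_sum ms) x = tetrahedral_sextic a b c d x"
    using Cons by auto
  obtain a' b' c' d' where **: "\<And>x. tetrahedral_sum (monomial m) x = tetrahedral_sextic a' b' c' d' x"
    using tetrahedral_sum_monomial[of i j k r] Cons(2) unfolding m by (auto simp: total_degree_def)
  have "tetrahedral_sum (monomial_sum (m # ms)) x
      = tetrahedral_sum (monomial m) x + tetrahedral_sum (monomial_sum ms) x" for x
    by (simp add: tetrahedral_sum_def)
  also have "\<dots> x = tetrahedral_sextic (a' + a) (b' + b) (c' + c) (d' + d) x" for x
    unfolding * ** by (simp add: tetrahedral_sextic_def algebra_simps)
  finally show ?case by blast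
qed

text \<open>Each factor vanishes on the two planes perpendicular to a pair of vertex axes, such as
  \<open>(1, \<phi>, 0)\<close> and \<open>(1, - \<phi>, 0)\<close> for the first one.\<close>

definition icosahedral_sextic :: "real^3 \<Rightarrow> real" where
  "icosahedral_sextic x =
     (x$1^2 - \<phi>^2 * x$2^2) * (x$2^2 - \<phi>^2 * x$3^2) * (x$3^2 - \<phi>^2 * x$1^2)"

lemma golden_less_3: "\<phi> < 3"
proof (rule ccontr)
  assume "\<not> \<phi> < 3"
  then have "3 * \<phi> \<le> \<phi> * \<phi>" by (intro mult_right_mono) auto
  then show False using golden_square golden_gt_1 by linarith
qed

lemma norm_power6: "norm x ^ 6 = (x$1^2 + x$2^2 + x$3^2) ^ 3" for x :: "real^3"
proof -
  have "norm x ^ 6 = (norm x ^ 2) ^ 3" by simp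
  also have "norm x ^ 2 = x$1^2 + x$2^2 + x$3^2"
    unfolding power2_norm_eq_inner by (simp add: inner_3 power2_eq_square)
  finally show ?thesis .
qed

text \<open>The half turn carries the edge direction \<open>(0, 1, 0)\<close> to \<open>(\<phi>, - 1, \<phi> - 1) / 2\<close> and the face
  direction \<open>(1, 1, 1)\<close> to \<open>(\<phi>, \<phi> - 1, 0)\<close>. Comparing the values at these two points gives two linear
  equations for the four coefficients, and their solutions are spanned by \<open>\<bar>x\<bar>\<^sup>6\<close> and the
  icosahedral sextic.\<close>

lemma tetrahedral_sextic_half_turn:
  assumes "\<And>x. tetrahedral_sextic a b c d (half_turn *v x) = tetrahedral_sextic a b c d x"
  shows "\<exists>\<alpha>. \<forall>x. tetrahedral_sextic a b c d x = a * norm x ^ 6 + \<alpha> * icosahedral_sextic x"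
proof -
  note g = golden_square
  have p: "\<phi>^2 = \<phi> + 1" "\<phi>^4 = 3 * \<phi> + 2" "\<phi>^6 = 8 * \<phi> + 5" using g by algebra+
  have q: "(\<phi> - 1)^2 = 2 - \<phi>" "(\<phi> - 1)^4 = 5 - 3 * \<phi>" "(\<phi> - 1)^6 = 13 - 8 * \<phi>" using g by algebra+
  have e1: "45 * a = (\<phi> + 6) * b + (7 - \<phi>) * c + d"
  proof -
    have "64 * tetrahedral_sextic a b c d (vector [0, 1, 0])
       = a * (\<phi>^6 + 1 + (\<phi> - 1)^6) + b * (\<phi>^4 + (\<phi> - 1)^2 + (\<phi> - 1)^4 * \<phi>^2)
         + c * (\<phi>^2 + (\<phi> - 1)^4 + (\<phi> - 1)^2 * \<phi>^4) + d * (\<phi>^2 * (\<phi> - 1)^2)"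
      using assms[of "vector [0, 1, 0]"]
      by (simp add: tetrahedral_sextic_def power_divide) (simp add: algebra_simps)
    then have "64 * a = a * (8 * \<phi> + 5 + 1 + (13 - 8 * \<phi>))
        + b * (3 * \<phi> + 2 + (2 - \<phi>) + (5 - 3 * \<phi>) * (\<phi> + 1))
        + c * (\<phi> + 1 + (5 - 3 * \<phi>) + (2 - \<phi>) * (3 * \<phi> + 2)) + d * ((\<phi> + 1) * (2 - \<phi>))"
      by (simp add: tetrahedral_sextic_def p q)
    with g show ?thesis by algebra
  qed
  have e2: "15 * a = (2 - \<phi>) * b + (1 + \<phi>) * c + d"
  proof -
    have "tetrahedral_sextic a b c d (vector [\<phi>, \<phi> - 1, 0]) = tetrahedral_sextic a b c d face_direction"
      using assms[of face_direction] by (simp add: half_turn_face)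
    then have "a * (8 * \<phi> + 5 + (13 - 8 * \<phi>)) + b * ((3 * \<phi> + 2) * (2 - \<phi>))
        + c * ((\<phi> + 1) * (5 - 3 * \<phi>)) = 3 * a + 3 * b + 3 * c + d"
      by (simp add: tetrahedral_sextic_def p q face_direction_def)
    with g show ?thesis by algebra
  qed
  \<comment> \<open>The coefficient of \<open>x\<^sub>1\<^sup>4 x\<^sub>2\<^sup>2\<close> is \<open>3\<close> in \<open>\<bar>x\<bar>\<^sup>6\<close> and \<open>- \<phi>\<^sup>2\<close> in the icosahedral sextic, and \<open>2 - \<phi> = \<phi>\<^sup>-\<^sup>2\<close>.\<close>
  define \<alpha> where "\<alpha> = (3 * a - b) * (2 - \<phi>)"
  have b: "b = 3 * a - (\<phi> + 1) * \<alpha>" unfolding \<alpha>_def using g by algebra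
  have "(3 - \<phi>) * (c - 3 * a - (3 * \<phi> + 2) * \<alpha>) = 0"
    using e1 e2 b g by algebra
  then have c: "c = 3 * a + (3 * \<phi> + 2) * \<alpha>" using golden_less_3 by simp
  have d: "d = 6 * a + (1 - (8 * \<phi> + 5)) * \<alpha>" using e2 b c g by algebra
  have "tetrahedral_sextic a b c d x = a * norm x ^ 6 + \<alpha> * icosahedral_sextic x" for x
    unfolding norm_power6 icosahedral_sextic_def tetrahedral_sextic_def b c d p
    using g by algebra
  then show ?thesis by blast
qed

text \<open>Averaging over the tetrahedral rotations does not change an invariant form, so the four-parameter
  family of averages of monomials already contains it.\<close>

theorem invariant_sextic:
  assumes P: "real_polynomial_function P" and hom: "\<And>t x. P (t *\<^sub>R x) = t ^ 6 * P x"
    and inv: "\<And>R x. R \<in> icosahedral_rotations \<Longrightarrow> P (R *v x) = P x"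
  shows "\<exists>a \<alpha>. \<forall>x. P x = a * norm x ^ 6 + \<alpha> * icosahedral_sextic x"
proof -
  obtain ms where ms: "\<And>x. P x = monomial_sum ms x"
    using real_polynomial_function_monomial_sum[OF P] by blast
  have "P x = monomial_sum (filter (\<lambda>m. total_degree m = 6) ms) x" for x
    unfolding ms by (rule homogeneous_monomial_sum[OF hom[unfolded ms]])
  then have P: "P = monomial_sum (filter (\<lambda>m. total_degree m = 6) ms)" by (rule ext)
  obtain a b c d where *: "\<And>x. tetrahedral_sum P x = tetrahedral_sextic a b c d x"
    using tetrahedral_sum_monomial_sum[of "filter (\<lambda>m. total_degree m = 6) ms"] unfolding P by auto
  have "tetrahedral_sum P x = 12 * P x" for x
    by (simp add: tetrahedral_sum_def inv tetrahedral_rotations)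
  then have 12: "12 * P x = tetrahedral_sextic a b c d x" for x by (simp add: *)
  then obtain \<alpha> where "\<And>x. 12 * P x = a * norm x ^ 6 + \<alpha> * icosahedral_sextic x"
    using tetrahedral_sextic_half_turn[of a b c d] inv[OF half_turn] by metis
  then have "P x = a / 12 * norm x ^ 6 + \<alpha> / 12 * icosahedral_sextic x" for x
    by (simp add: field_simps)
  then show ?thesis by blast
qed

section \<open>The icosahedral sextic and its derivatives\<close>

text \<open>The polar form of the quadratic factors of the icosahedral sextic. Written with it, the sextic
  and its first two derivatives are polynomials in three bilinear forms.\<close>

definition golden_form :: "3 \<Rightarrow> 3 \<Rightarrow> real^3 \<Rightarrow> real^3 \<Rightarrow> real" where
  "golden_form i j x y = x$i * y$i - \<phi>^2 * (x$j * y$j)"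

definition sextic_deriv :: "real^3 \<Rightarrow> real^3 \<Rightarrow> real" where
  "sextic_deriv x u =
     2 * (golden_form 1 2 x u * golden_form 2 3 x x * golden_form 3 1 x x
        + golden_form 1 2 x x * golden_form 2 3 x u * golden_form 3 1 x x
        + golden_form 1 2 x x * golden_form 2 3 x x * golden_form 3 1 x u)"

definition sextic_deriv2 :: "real^3 \<Rightarrow> real^3 \<Rightarrow> real^3 \<Rightarrow> real" where
  "sextic_deriv2 x u v =
     2 * (golden_form 1 2 u v * golden_form 2 3 x x * golden_form 3 1 x x
        + golden_form 1 2 x x * golden_form 2 3 u v * golden_form 3 1 x x
        + golden_form 1 2 x x * golden_form 2 3 x x * golden_form 3 1 u v)
   + 4 * (golden_form 1 2 x u * golden_form 2 3 x v * golden_form 3 1 x x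
        + golden_form 1 2 x v * golden_form 2 3 x u * golden_form 3 1 x x
        + golden_form 1 2 x u * golden_form 2 3 x x * golden_form 3 1 x v
        + golden_form 1 2 x v * golden_form 2 3 x x * golden_form 3 1 x u
        + golden_form 1 2 x x * golden_form 2 3 x u * golden_form 3 1 x v
        + golden_form 1 2 x x * golden_form 2 3 x v * golden_form 3 1 x u)"

lemma icosahedral_sextic_forms:
  "icosahedral_sextic x = golden_form 1 2 x x * golden_form 2 3 x x * golden_form 3 1 x x"
  by (simp add: icosahedral_sextic_def golden_form_def power2_eq_square)

lemma golden_form_commute: "golden_form i j x y = golden_form i j y x"
  by (simp add: golden_form_def mult.commute)

lemma bounded_bilinear_golden_form: "bounded_bilinear (golden_form i j)"
  unfolding bilinear_conv_bounded_bilinear[symmetric] bilinear_def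
  by (auto intro!: linearI simp: golden_form_def algebra_simps)

lemmas has_derivative_golden_form = bounded_bilinear.FDERIV[OF bounded_bilinear_golden_form]

lemmas golden_form_simps = bounded_bilinear.add_left[OF bounded_bilinear_golden_form]
  bounded_bilinear.add_right[OF bounded_bilinear_golden_form]
  bounded_bilinear.scaleR_left[OF bounded_bilinear_golden_form]
  bounded_bilinear.scaleR_right[OF bounded_bilinear_golden_form]

lemma has_derivative_icosahedral_sextic:
  assumes a: "(a has_derivative a') (at p)"
  shows "((\<lambda>q. icosahedral_sextic (a q)) has_derivative (\<lambda>v. sextic_deriv (a p) (a' v))) (at p)"
  unfolding icosahedral_sextic_forms
  by (rule has_derivative_eq_rhs, (rule has_derivative_mult has_derivative_golden_form a)+)
    (simp add: sextic_deriv_def golden_form_commute[of _ _ "a' _"] fun_eq_iff algebra_simps)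

lemma has_derivative_sextic_deriv:
  assumes a: "(a has_derivative a') (at p)" and b: "(b has_derivative b') (at p)"
  shows "((\<lambda>q. sextic_deriv (a q) (b q)) has_derivative
     (\<lambda>v. sextic_deriv2 (a p) (b p) (a' v) + sextic_deriv (a p) (b' v))) (at p)"
  unfolding sextic_deriv_def
  by (rule has_derivative_eq_rhs, (rule has_derivative_mult_right has_derivative_add has_derivative_mult has_derivative_golden_form a b)+)
    (simp add: sextic_deriv2_def golden_form_commute[of _ _ "a' _"] fun_eq_iff algebra_simps)

lemma bounded_linear_sextic_deriv: "bounded_linear (sextic_deriv x)"
  using has_derivative_bounded_linear[OF has_derivative_icosahedral_sextic[OF has_derivative_ident]] .

lemma sextic_deriv2_commute: "sextic_deriv2 x u v = sextic_deriv2 x v u"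
  by (simp add: sextic_deriv2_def golden_form_commute[of _ _ u v] algebra_simps)

lemma bounded_linear_sextic_deriv2: "bounded_linear (sextic_deriv2 x u)"
  using has_derivative_bounded_linear[OF has_derivative_sextic_deriv[OF has_derivative_ident has_derivative_const]]
  by (simp add: linear_0[OF bounded_linear.linear[OF bounded_linear_sextic_deriv]])

lemma icosahedral_sextic_scaleR: "icosahedral_sextic (c *\<^sub>R x) = c ^ 6 * icosahedral_sextic x"
  by (simp add: icosahedral_sextic_forms golden_form_simps power_numeral_reduce)

lemma sextic_deriv2_scaleR: "sextic_deriv2 (c *\<^sub>R x) u v = c ^ 4 * sextic_deriv2 x u v"
  by (simp add: sextic_deriv2_def golden_form_simps power_numeral_reduce algebra_simps)

lemma sextic_deriv_self: "sextic_deriv x x = 6 * icosahedral_sextic x"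
  by (simp add: sextic_deriv_def icosahedral_sextic_forms)

text \<open>Differentiating the identity \<open>G (R x) = G x\<close> gives the invariance of the derivatives.\<close>

lemma sextic_deriv_invariant:
  assumes R: "\<And>x. icosahedral_sextic (R *v x) = icosahedral_sextic x"
  shows "sextic_deriv (R *v x) (R *v u) = sextic_deriv x u"
proof -
  have R': "((\<lambda>x. R *v x) has_derivative (\<lambda>v. R *v v)) (at x)"
    by (intro bounded_linear_imp_has_derivative matrix_vector_mul_bounded_linear)
  have "((\<lambda>x. icosahedral_sextic (R *v x)) has_derivative (\<lambda>v. sextic_deriv (R *v x) (R *v v))) (at x)"
    by (rule has_derivative_icosahedral_sextic[OF R'])
  moreover have "((\<lambda>x. icosahedral_sextic (R *v x)) has_derivative (\<lambda>v. sextic_deriv x v)) (at x)"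
    unfolding R by (rule has_derivative_icosahedral_sextic[OF has_derivative_ident])
  ultimately show ?thesis by (metis has_derivative_unique)
qed

lemma sextic_deriv2_invariant:
  assumes R: "\<And>x. icosahedral_sextic (R *v x) = icosahedral_sextic x"
  shows "sextic_deriv2 (R *v x) (R *v u) (R *v v) = sextic_deriv2 x u v"
proof -
  have R': "((\<lambda>x. R *v x) has_derivative (\<lambda>v. R *v v)) (at x)"
    by (intro bounded_linear_imp_has_derivative matrix_vector_mul_bounded_linear)
  have "((\<lambda>x. sextic_deriv (R *v x) (R *v u)) has_derivative
      (\<lambda>v. sextic_deriv2 (R *v x) (R *v u) (R *v v) + sextic_deriv (R *v x) 0)) (at x)"
    by (intro has_derivative_sextic_deriv[OF R'] derivative_intros)
  moreover have "((\<lambda>x. sextic_deriv (R *v x) (R *v u)) has_derivative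
      (\<lambda>v. sextic_deriv2 x u v + sextic_deriv x 0)) (at x)"
    unfolding sextic_deriv_invariant[OF R]
    by (intro has_derivative_sextic_deriv has_derivative_ident derivative_intros)
  ultimately have "sextic_deriv2 (R *v x) (R *v u) (R *v v) + sextic_deriv (R *v x) 0
      = sextic_deriv2 x u v + sextic_deriv x 0"
    by (metis has_derivative_unique)
  then show ?thesis
    by (simp add: linear_0[OF bounded_linear.linear[OF bounded_linear_sextic_deriv]])
qed

section \<open>Critical points of the icosahedral sextic on the sphere\<close>

definition tangentially_critical :: "real^3 \<Rightarrow> bool" where
  "tangentially_critical x \<longleftrightarrow> (\<forall>u. x \<bullet> u = 0 \<longrightarrow> sextic_deriv x u = 0)"

text \<open>The gradient \<open>g\<close> at a fixed point of \<open>R\<close> is itself fixed by \<open>R\<close>. The fixed vectors of a nontrivial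
  rotation form its axis, so \<open>g\<close> is parallel to \<open>x\<close>.\<close>

lemma fixed_point_tangentially_critical:
  assumes R: "R \<in> SO3" "\<And>x. icosahedral_sextic (R *v x) = icosahedral_sextic x"
    and fixed: "R *v x = x" and nontrivial: "R \<noteq> mat 1"
  shows "tangentially_critical x"
proof -
  interpret bounded_linear "sextic_deriv x" by (rule bounded_linear_sextic_deriv)
  define g where "g = (\<Sum>b\<in>Basis. sextic_deriv x b *\<^sub>R b)"
  have g: "sextic_deriv x u = g \<bullet> u" for u
  proof -
    have "sextic_deriv x u = sextic_deriv x (\<Sum>b\<in>Basis. (u \<bullet> b) *\<^sub>R b)"
      by (simp add: euclidean_representation)
    also have "\<dots> = g \<bullet> u"
      by (simp add: sum scaleR g_def inner_sum_left inner_commute[of u] mult.commute)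
    finally show ?thesis .
  qed
  have "(R *v g) \<bullet> (R *v u) = g \<bullet> (R *v u)" for u
    using sextic_deriv_invariant[OF R(2), of x u] by (simp add: fixed g SO3_inner R)
  then have "(R *v g - g) \<bullet> w = 0" for w
    using SO3_transpose_mult(4)[OF R(1), of w] by (metis inner_diff_left right_minus_eq)
  then have "R *v g = g" by (metis inner_eq_zero_iff right_minus_eq)
  then have "cross3 x g = 0"
    using SO3_fixing_two[OF R(1) fixed] nontrivial by blast
  then have "u = 0 \<or> g \<bullet> u = 0" if "x \<bullet> u = 0" for u
  proof -
    have "cross3 u (cross3 x g) = (u \<bullet> g) *\<^sub>R x - (u \<bullet> x) *\<^sub>R g"
      by (simp add: cross3_simps forall_3)
    then have "(u \<bullet> g) *\<^sub>R x = 0" using \<open>cross3 x g = 0\<close> that by (simp add: inner_commute)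
    moreover have "sextic_deriv x u = 0" if "x = 0"
      unfolding that sextic_deriv_def by (simp add: golden_form_def)
    ultimately show ?thesis using g by (auto simp: inner_commute)
  qed
  then show ?thesis unfolding tangentially_critical_def g by (metis inner_zero_right)
qed

text \<open>The signs of the coordinates differ in an even or odd number of places; in the first case a half
  turn about a coordinate axis or the identity corrects them, in the second case this leads to the
  antipode.\<close>

lemma ico_proportional_equal_squares:
  assumes "x$1^2 = y$1^2" "x$2^2 = y$2^2" "x$3^2 = y$3^2"
  shows "ico_proportional x y"
proof -
  have *: "ico_proportional x y" if "R \<in> {mat 1, flip1, flip2, flip3}" "R *v x = y \<or> R *v x = - y" for R
    using that icosahedral_mat_1 tetrahedral_rotations
    by (auto intro: ico_proportionalI[of R 1] ico_proportionalI[of R "-1"])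
  have "x$1 = y$1 \<or> x$1 = - y$1" "x$2 = y$2 \<or> x$2 = - y$2" "x$3 = y$3 \<or> x$3 = - y$3"
    using assms by (simp_all add: power2_eq_iff)
  then have "x = y \<or> x = - y \<or> flip1 *v x = y \<or> flip1 *v x = - y
      \<or> flip2 *v x = y \<or> flip2 *v x = - y \<or> flip3 *v x = y \<or> flip3 *v x = - y"
    by (elim disjE; simp add: vec_eq_3)
  then show ?thesis using *[of "mat 1"] *[of flip1] *[of flip2] *[of flip3] by fastforce
qed

lemma ico_proportional_cycle: "ico_proportional (cycle *v x) y \<Longrightarrow> ico_proportional x y"
  by (rule ico_proportional_trans[of _ "cycle *v x"])
    (auto intro: ico_proportionalI[of "cycle" 1] tetrahedral_rotations)

text \<open>The Lagrange equation obtained from the tangent vector \<open>(x\<^sub>2, - x\<^sub>1, 0)\<close>, in terms of the three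
  quadratic factors \<open>p\<close>, \<open>q\<close>, \<open>r\<close>. The other two equations arise by cyclic permutation of the
  coordinates, which also permutes the factors cyclically.\<close>

definition cyclic_equation :: "real^3 \<Rightarrow> bool" where
  "cyclic_equation x \<longleftrightarrow>
    (let s = \<phi>^2; p = golden_form 1 2 x x; q = golden_form 2 3 x x; r = golden_form 3 1 x x
     in x$1 * x$2 * ((1 + s) * q * r - p * r - s * p * q) = 0)"

lemma icosahedral_sextic_cycle: "icosahedral_sextic (cycle *v x) = icosahedral_sextic x"
  by (simp add: icosahedral_sextic_def)

lemma cycle_inverse: "cycle *v (cycle *v (cycle *v u)) = u"
  by (simp add: vec_eq_3)

lemma tangentially_critical_cycle:
  assumes "tangentially_critical x" shows "tangentially_critical (cycle *v x)"
  unfolding tangentially_critical_def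
proof (intro allI impI)
  fix u assume "(cycle *v x) \<bullet> u = 0"
  then have "x \<bullet> (cycle *v (cycle *v u)) = 0" by (simp add: inner_3 algebra_simps)
  then have "sextic_deriv x (cycle *v (cycle *v u)) = 0"
    using assms by (simp add: tangentially_critical_def)
  then show "sextic_deriv (cycle *v x) u = 0"
    using sextic_deriv_invariant[of "cycle" x "cycle *v (cycle *v u)"]
    by (simp add: icosahedral_sextic_cycle cycle_inverse)
qed

lemma tangentially_critical_cyclic_equation:
  assumes "tangentially_critical x" shows "cyclic_equation x"
proof -
  let ?u = "vector [x$2, - x$1, 0] :: real^3"
  have "x \<bullet> ?u = 0" by (simp add: inner_3)
  then have "sextic_deriv x ?u = 0" using assms by (simp add: tangentially_critical_def)
  then show ?thesis
    unfolding cyclic_equation_def Let_def sextic_deriv_def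
    by (simp add: golden_form_def) algebra
qed

definition special_direction :: "real^3 \<Rightarrow> bool" where
  "special_direction x \<longleftrightarrow>
     (\<exists>e\<in>{edge_direction, face_direction, vertex_direction}. ico_proportional x e)"

lemma special_direction_trans: "ico_proportional x y \<Longrightarrow> special_direction y \<Longrightarrow> special_direction x"
  using ico_proportional_trans by (auto simp: special_direction_def)

lemma special_direction_cycle: "special_direction (cycle *v x) \<Longrightarrow> special_direction x"
  using ico_proportional_cycle by (auto simp: special_direction_def)

text \<open>These are the representatives in which the solutions of the Lagrange equations appear.\<close>

lemma special_direction_examples:
  "special_direction edge_direction" "special_direction (vector [1, 1, 1])"
  "special_direction (vector [1, \<phi>, 0])" "special_direction (vector [\<phi>, \<phi> - 1, 0])"
  "special_direction (vector [\<phi>, -1, \<phi> - 1])"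
proof -
  show "special_direction edge_direction" "special_direction (vector [1, 1, 1])"
    by (auto simp: special_direction_def face_direction_def
        intro: ico_proportionalI[of "mat 1" 1] icosahedral_mat_1)
  have "cycle *v (cycle *v (vector [1, \<phi>, 0])) = vertex_direction"
    by (simp add: vec_eq_3 vertex_direction_def)
  then have "ico_proportional (vector [1, \<phi>, 0]) vertex_direction"
    by (intro ico_proportionalI[of "cycle ** cycle" 1])
      (simp_all add: icosahedral_mult tetrahedral_rotations flip: matrix_vector_mul_assoc)
  then show "special_direction (vector [1, \<phi>, 0])" by (auto simp: special_direction_def)
  have "half_turn *v vector [\<phi>, \<phi> - 1, 0] = face_direction"
    by (simp add: vec_eq_3 face_direction_def golden_square algebra_simps)
  then have "ico_proportional (vector [\<phi>, \<phi> - 1, 0]) face_direction"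
    by (intro ico_proportionalI[of half_turn 1]) (simp_all add: half_turn)
  then show "special_direction (vector [\<phi>, \<phi> - 1, 0])" by (auto simp: special_direction_def)
  have "cycle *v (half_turn *v vector [\<phi>, -1, \<phi> - 1]) = 2 *\<^sub>R edge_direction"
    by (simp add: vec_eq_3 edge_direction_def golden_square algebra_simps)
  then have "ico_proportional (vector [\<phi>, -1, \<phi> - 1]) edge_direction"
    by (intro ico_proportionalI[of "cycle ** half_turn" 2])
      (simp_all add: icosahedral_mult tetrahedral_rotations half_turn flip: matrix_vector_mul_assoc)
  then show "special_direction (vector [\<phi>, -1, \<phi> - 1])" by (auto simp: special_direction_def)
qed

lemma special_direction_squares:
  assumes y: "special_direction y" and c: "c \<noteq> 0"
    and "x$1^2 = c^2 * y$1^2" "x$2^2 = c^2 * y$2^2" "x$3^2 = c^2 * y$3^2"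
  shows "special_direction x"
proof -
  have "ico_proportional x (c *\<^sub>R y)"
    by (rule ico_proportional_equal_squares) (simp_all add: assms power_mult_distrib)
  moreover have "ico_proportional (c *\<^sub>R y) y"
    using c by (intro ico_proportionalI[of "mat 1" c]) (simp_all add: icosahedral_mat_1)
  ultimately show ?thesis using y special_direction_trans by blast
qed

text \<open>If no other coordinate vanishes, the remaining equation is quadratic in the ratio
  \<open>x\<^sub>1\<^sup>2 / x\<^sub>2\<^sup>2\<close> with roots \<open>\<phi>\<^sup>4\<close>, a face center, and \<open>\<phi>\<^sup>-\<^sup>2\<close>, a vertex.\<close>

lemma critical_on_coordinate_plane:
  assumes x: "x \<noteq> 0" "x$3 = 0" and eq: "cyclic_equation x"
  shows "special_direction x"
proof -
  note g = golden_square
  consider "x$1 = 0" "x$2 \<noteq> 0" | "x$1 \<noteq> 0" "x$2 = 0" | "x$1 \<noteq> 0" "x$2 \<noteq> 0"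
    using x by (auto simp: vec_eq_3)
  then show ?thesis
  proof cases
    case 1
    have "special_direction (cycle *v x)"
      by (rule special_direction_squares[OF special_direction_examples(1), of "x$2"];
        use 1 x in \<open>simp add: edge_direction_def\<close>)
    then show ?thesis by (rule special_direction_cycle)
  next
    case 2
    show ?thesis
      by (rule special_direction_squares[OF special_direction_examples(1), of "x$1"];
        use 2 x in \<open>simp add: edge_direction_def\<close>)
  next
    case 3
    have "(1 + \<phi>^2) * (x$2^2 * (- (\<phi>^2 * x$1^2))) - (x$1^2 - \<phi>^2 * x$2^2) * (- (\<phi>^2 * x$1^2))
        - \<phi>^2 * ((x$1^2 - \<phi>^2 * x$2^2) * x$2^2) = 0"
      using eq 3 x by (simp add: cyclic_equation_def Let_def golden_form_def power2_eq_square)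
    then have "(x$1^2 - \<phi>^4 * x$2^2) * (x$2^2 - \<phi>^2 * x$1^2) = 0"
      using g by algebra
    then consider "x$1^2 = \<phi>^4 * x$2^2" | "x$2^2 = \<phi>^2 * x$1^2" by auto
    then show ?thesis
    proof cases
      case 1
      have "\<phi> * (\<phi> - 1) = 1" using g by algebra
      then have "\<phi>^2 * (\<phi> - 1)^2 = 1" by (metis power_mult_distrib power_one)
      with 1 3 x show ?thesis
        by (intro special_direction_squares[OF special_direction_examples(4), of "\<phi> * x$2"];
          simp add: power_mult_distrib mult.assoc mult.left_commute)
    next
      case 2
      show ?thesis
        by (rule special_direction_squares[OF special_direction_examples(3), of "x$1"];
          use 2 3 x in \<open>simp add: mult.commute\<close>)
    qed
  qed
qed

text \<open>Two of the three factors vanish together at edge midpoints.\<close>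

lemma critical_off_coordinate_planes_degenerate:
  assumes x: "x$1 \<noteq> 0" "x$2 \<noteq> 0" "x$3 \<noteq> 0"
    and pq: "golden_form 1 2 x x = 0" "golden_form 2 3 x x = 0"
  shows "special_direction x"
proof (rule special_direction_squares[OF special_direction_examples(5), of "\<phi> * x$3"])
  have "\<phi> * (\<phi> - 1) = 1" using golden_square by algebra
  then have "\<phi>^2 * (\<phi> - 1)^2 = 1" by (metis power_mult_distrib power_one)
  then show "x$3^2 = (\<phi> * x$3)^2 * (vector [\<phi>, -1, \<phi> - 1] :: real^3)$3^2"
    by (simp add: power_mult_distrib algebra_simps)
qed (use pq x in \<open>simp_all add: golden_form_def power_mult_distrib power2_eq_square algebra_simps\<close>)

text \<open>The equations are linear in \<open>q r\<close>, \<open>r p\<close>, \<open>p q\<close>. If one factor vanishes, so does a second one. Otherwise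
  the three products coincide, because the circulant system has rank two; hence \<open>p = q = r\<close>, which is
  again a circulant system, now for the squares of the coordinates, and forces these to be equal.\<close>

lemma critical_off_coordinate_planes:
  assumes x: "x$1 \<noteq> 0" "x$2 \<noteq> 0" "x$3 \<noteq> 0"
    and eq: "cyclic_equation x" "cyclic_equation (cycle *v x)" "cyclic_equation (cycle *v (cycle *v x))"
  shows "special_direction x"
proof -
  have cyc: "golden_form 1 2 (cycle *v y) (cycle *v y) = golden_form 2 3 y y"
    "golden_form 2 3 (cycle *v y) (cycle *v y) = golden_form 3 1 y y"
    "golden_form 3 1 (cycle *v y) (cycle *v y) = golden_form 1 2 y y" for y
    by (simp_all add: golden_form_def)
  define s p q r where spqr: "s = \<phi>^2" "p = golden_form 1 2 x x" "q = golden_form 2 3 x x"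
    "r = golden_form 3 1 x x"
  have s: "s > 0" by (simp add: spqr)
  have "(1 + s) * q * r - p * r - s * p * q = 0" "(1 + s) * r * p - q * p - s * q * r = 0"
    "(1 + s) * p * q - r * q - s * r * p = 0"
    using eq x unfolding cyclic_equation_def Let_def cyc spqr[symmetric] by simp_all
  then have eqs: "(1 + s) * (q * r) = r * p + s * (p * q)" "(1 + s) * (r * p) = p * q + s * (q * r)"
    "(1 + s) * (p * q) = q * r + s * (r * p)"
    by (simp_all add: algebra_simps)
  have "0 < 1 + s + s^2" using s by (intro add_pos_nonneg) auto
  then have sum_pos: "1 + s + s^2 \<noteq> 0" by simp
  have degenerate: "special_direction x" if "p = 0 \<and> q = 0 \<or> q = 0 \<and> r = 0 \<or> r = 0 \<and> p = 0"
    using that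
  proof (elim disjE conjE)
    assume "p = 0" "q = 0"
    then show ?thesis using x by (intro critical_off_coordinate_planes_degenerate) (auto simp: spqr)
  next
    assume "q = 0" "r = 0"
    then have "special_direction (cycle *v x)"
      using x by (intro critical_off_coordinate_planes_degenerate) (auto simp: spqr cyc)
    then show ?thesis by (rule special_direction_cycle)
  next
    assume "r = 0" "p = 0"
    then have "special_direction (cycle *v (cycle *v x))"
      using x by (intro critical_off_coordinate_planes_degenerate) (auto simp: spqr cyc)
    then show ?thesis by (blast intro: special_direction_cycle)
  qed
  show ?thesis
  proof (cases "p = 0 \<or> q = 0 \<or> r = 0")
    case True
    then show ?thesis using eqs s by (intro degenerate) (elim disjE; auto)
  next
    case False
    have "(1 + s + s^2) * (q * r - r * p) = 0" "(1 + s + s^2) * (r * p - p * q) = 0"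
      using eqs by algebra+
    then have "p = q" "q = r" using False sum_pos by simp_all
    then have lin: "x$1^2 - x$2^2 = s * (x$2^2 - x$3^2)" "x$2^2 - x$3^2 = s * (x$3^2 - x$1^2)"
      by (simp_all add: spqr golden_form_def power2_eq_square algebra_simps)
    then have "(1 + s + s^2) * (x$2^2 - x$3^2) = 0" by algebra
    then have "x$2^2 = x$3^2" using sum_pos by simp
    then have "x$1^2 = x$2^2" "x$3^2 = x$2^2" using lin by auto
    with x show ?thesis
      by (intro special_direction_squares[OF special_direction_examples(2), of "x$2"]; simp)
  qed
qed

theorem tangentially_critical_special_direction:
  assumes x: "x \<noteq> 0" and crit: "tangentially_critical x"
  shows "special_direction x"
proof -
  let ?y = "cycle *v x" and ?z = "cycle *v (cycle *v x)"
  have eq: "cyclic_equation x" "cyclic_equation ?y" "cyclic_equation ?z"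
    using crit by (simp_all add: tangentially_critical_cyclic_equation tangentially_critical_cycle)
  have nz: "?y \<noteq> 0" "?z \<noteq> 0" using x by (auto simp: vec_eq_3)
  consider "x$3 = 0" | "?y$3 = 0" | "?z$3 = 0" | "x$1 \<noteq> 0" "x$2 \<noteq> 0" "x$3 \<noteq> 0" by auto
  then show ?thesis
  proof cases
    case 1 then show ?thesis using critical_on_coordinate_plane x eq by blast
  next
    case 2 then show ?thesis using critical_on_coordinate_plane nz eq special_direction_cycle by blast
  next
    case 3 then show ?thesis using critical_on_coordinate_plane nz eq special_direction_cycle by blast
  next
    case 4 then show ?thesis using critical_off_coordinate_planes eq by blast
  qed
qed

section \<open>Nondegeneracy\<close>

text \<open>On the unit sphere the Hessian of a form \<open>G\<close> of degree six at a critical point is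
  \<open>D\<^sup>2G(u, v) - 6 G (u \<bullet> v)\<close> on tangent vectors, because the radial derivative of \<open>G\<close> is \<open>6 G\<close>. The factor
  \<open>x \<bullet> x\<close> makes the condition independent of the length of \<open>x\<close>.\<close>

definition nondegenerate_direction :: "real^3 \<Rightarrow> bool" where
  "nondegenerate_direction x \<longleftrightarrow>
     (\<forall>u. x \<bullet> u = 0 \<longrightarrow>
        (\<forall>v. x \<bullet> v = 0 \<longrightarrow> (x \<bullet> x) * sextic_deriv2 x u v = 6 * icosahedral_sextic x * (u \<bullet> v)) \<longrightarrow> u = 0)"

text \<open>At an axis of order at least three the Hessian is a multiple \<open>k\<close> of the metric, so only its values
  on the diagonal have to be computed.\<close>

lemma nondegenerate_directionI:
  assumes "\<And>u. x \<bullet> u = 0 \<Longrightarrow>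
    (x \<bullet> x) * sextic_deriv2 x u u - 6 * icosahedral_sextic x * (u \<bullet> u) = k * (u \<bullet> u)" and "k \<noteq> 0"
  shows "nondegenerate_direction x"
  unfolding nondegenerate_direction_def using assms by force

lemma nondegenerate_edge: "nondegenerate_direction edge_direction"
  unfolding nondegenerate_direction_def
proof (intro allI impI)
  fix u :: "real^3"
  assume u: "edge_direction \<bullet> u = 0" and h: "\<forall>v. edge_direction \<bullet> v = 0 \<longrightarrow>
    (edge_direction \<bullet> edge_direction) * sextic_deriv2 edge_direction u v
      = 6 * icosahedral_sextic edge_direction * (u \<bullet> v)"
  show "u = 0"
    using u h[rule_format, of "vector [0, 1, 0]"] h[rule_format, of "vector [0, 0, 1]"]
    by (simp add: edge_direction_def inner_3 vec_eq_3 sextic_deriv2_def icosahedral_sextic_def golden_form_def)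
qed

lemma nondegenerate_face: "nondegenerate_direction face_direction"
proof (rule nondegenerate_directionI)
  fix u :: "real^3" assume "face_direction \<bullet> u = 0"
  then have u: "u$3 = - u$1 - u$2" by (simp add: face_direction_def inner_3)
  have p: "\<phi>^2 = \<phi> + 1" using golden_square by (simp add: power2_eq_square)
  show "(face_direction \<bullet> face_direction) * sextic_deriv2 face_direction u u
    - 6 * icosahedral_sextic face_direction * (u \<bullet> u) = (48 + 96 * \<phi>) * (u \<bullet> u)"
    unfolding sextic_deriv2_def icosahedral_sextic_forms golden_form_def inner_3 u p
    using golden_square by (simp add: face_direction_def) algebra
qed (use golden_gt_1 in simp)

lemma nondegenerate_vertex: "nondegenerate_direction vertex_direction"
proof (rule nondegenerate_directionI)
  fix u :: "real^3" assume "vertex_direction \<bullet> u = 0"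
  then have u: "u$2 = - (\<phi> * u$3)" by (simp add: vertex_direction_def inner_3)
  have p: "\<phi>^2 = \<phi> + 1" using golden_square by (simp add: power2_eq_square)
  show "(vertex_direction \<bullet> vertex_direction) * sextic_deriv2 vertex_direction u u
    - 6 * icosahedral_sextic vertex_direction * (u \<bullet> u) = - (176 + 288 * \<phi>) * (u \<bullet> u)"
    unfolding sextic_deriv2_def icosahedral_sextic_forms golden_form_def inner_3 u p
    using golden_square by (simp add: vertex_direction_def) algebra
qed (use golden_gt_1 in simp)

lemma nondegenerate_direction_proportional:
  assumes G: "\<And>R x. R \<in> icosahedral_rotations \<Longrightarrow> icosahedral_sextic (R *v x) = icosahedral_sextic x"
    and xy: "ico_proportional x y" and y: "nondegenerate_direction y"
  shows "nondegenerate_direction x"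
  unfolding nondegenerate_direction_def
proof (intro allI impI)
  fix u assume u: "x \<bullet> u = 0" and h: "\<forall>v. x \<bullet> v = 0 \<longrightarrow>
    (x \<bullet> x) * sextic_deriv2 x u v = 6 * icosahedral_sextic x * (u \<bullet> v)"
  obtain R c where R: "R \<in> icosahedral_rotations" and c: "c \<noteq> 0" "R *v x = c *\<^sub>R y"
    using xy by (auto simp: ico_proportional_def)
  note S = icosahedral_SO3[OF R]
  have "x \<bullet> v = c * (y \<bullet> (R *v v))" for v
    using SO3_inner[OF S, of x v] by (simp add: c(2))
  then have perp: "x \<bullet> v = 0 \<longleftrightarrow> y \<bullet> (R *v v) = 0" for v using c(1) by simp
  have "R *v u = 0"
  proof (rule y[unfolded nondegenerate_direction_def, rule_format])
    show "y \<bullet> (R *v u) = 0" using u perp by simp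
    fix w assume "y \<bullet> w = 0"
    then have "x \<bullet> (transpose R *v w) = 0" by (simp add: perp SO3_transpose_mult[OF S])
    then have "(x \<bullet> x) * sextic_deriv2 x u (transpose R *v w)
        = 6 * icosahedral_sextic x * (u \<bullet> (transpose R *v w))"
      using h by blast
    moreover have "sextic_deriv2 x u (transpose R *v w) = c^4 * sextic_deriv2 y (R *v u) w"
      using sextic_deriv2_invariant[OF G[OF R], of x u "transpose R *v w"]
      by (simp add: c sextic_deriv2_scaleR SO3_transpose_mult[OF S])
    moreover have "icosahedral_sextic x = c^6 * icosahedral_sextic y"
      using G[OF R, of x] by (simp add: c icosahedral_sextic_scaleR)
    moreover have "x \<bullet> x = c^2 * (y \<bullet> y)"
      using SO3_inner[OF S, of x x] by (simp add: c power2_eq_square)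
    moreover have "u \<bullet> (transpose R *v w) = (R *v u) \<bullet> w"
      using SO3_inner[OF S, of u "transpose R *v w"] by (simp add: SO3_transpose_mult[OF S])
    ultimately have "c^6 * ((y \<bullet> y) * sextic_deriv2 y (R *v u) w)
        = c^6 * (6 * icosahedral_sextic y * ((R *v u) \<bullet> w))"
      by (simp add: algebra_simps power_numeral_reduce)
    then show "(y \<bullet> y) * sextic_deriv2 y (R *v u) w = 6 * icosahedral_sextic y * ((R *v u) \<bullet> w)"
      using c by simp
  qed
  then show "u = 0" using SO3_inj[OF S, of u 0] by simp
qed

section \<open>The Hopf map\<close>

lemma vec_eq_2: "p = q \<longleftrightarrow> p$1 = q$1 \<and> p$2 = q$2" for p q :: "'a^2"
  by (simp add: vec_eq_iff forall_2)

lemma inner_complex_2: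
  "p \<bullet> q = Re (p$1) * Re (q$1) + Im (p$1) * Im (q$1) + Re (p$2) * Re (q$2) + Im (p$2) * Im (q$2)"
  for p q :: "complex^2"
  by (simp add: inner_vec_def sum_2 inner_complex_def)

lemma norm_complex_2: "norm p ^ 2 = cmod (p$1) ^ 2 + cmod (p$2) ^ 2" for p :: "complex^2"
  unfolding power2_norm_eq_inner[of p] inner_complex_2 cmod_power2 by (simp add: power2_eq_square)

lemma norm_vector_smult: "norm (z *s p) = cmod z * norm p" for p :: "complex^2"
proof (rule power2_eq_imp_eq)
  show "norm (z *s p) ^ 2 = (cmod z * norm p) ^ 2"
    by (simp add: norm_complex_2 power_mult_distrib norm_mult distrib_left)
qed simp_all

text \<open>The Hopf map is a quadratic form with values in \<open>real^3\<close>; this is its symmetric bilinear form, so that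
  the differential of the Hopf map at \<open>p\<close> is \<open>2 *\<^sub>R hopf_polar p v\<close>.\<close>

definition hopf_polar :: "complex^2 \<Rightarrow> complex^2 \<Rightarrow> real^3" where
  "hopf_polar p q = vector [Re (p$1 * cnj (q$2)) + Re (q$1 * cnj (p$2)),
     Im (p$1 * cnj (q$2)) + Im (q$1 * cnj (p$2)), Re (p$1 * cnj (q$1)) - Re (p$2 * cnj (q$2))]"

lemma hopf_components:
  "hopf p $ 1 = 2 * (Re (p$1) * Re (p$2) + Im (p$1) * Im (p$2))"
  "hopf p $ 2 = 2 * (Im (p$1) * Re (p$2) - Re (p$1) * Im (p$2))"
  "hopf p $ 3 = Re (p$1)^2 + Im (p$1)^2 - Re (p$2)^2 - Im (p$2)^2"
  by (simp_all add: hopf_def cmod_power2)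

lemma hopf_polar_components:
  "hopf_polar p q $ 1 = Re (p$1) * Re (q$2) + Im (p$1) * Im (q$2) + Re (q$1) * Re (p$2) + Im (q$1) * Im (p$2)"
  "hopf_polar p q $ 2 = Im (p$1) * Re (q$2) - Re (p$1) * Im (q$2) + Im (q$1) * Re (p$2) - Re (q$1) * Im (p$2)"
  "hopf_polar p q $ 3 = Re (p$1) * Re (q$1) + Im (p$1) * Im (q$1) - Re (p$2) * Re (q$2) - Im (p$2) * Im (q$2)"
  by (simp_all add: hopf_polar_def)

lemma hopf_polar_self: "hopf_polar p p = hopf p"
  by (simp add: vec_eq_3 hopf_components hopf_polar_components power2_eq_square)

lemma hopf_polar_commute: "hopf_polar p q = hopf_polar q p"
  by (simp add: vec_eq_3 hopf_polar_components)

lemma bounded_bilinear_hopf_polar: "bounded_bilinear hopf_polar"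
  unfolding bilinear_conv_bounded_bilinear[symmetric] bilinear_def
  by (auto intro!: linearI simp: vec_eq_3 hopf_polar_components algebra_simps)

lemma norm_hopf: "norm (hopf p) = norm p ^ 2"
proof -
  have "norm (hopf p) ^ 2 = (norm p ^ 2) ^ 2"
    unfolding power2_norm_eq_inner inner_3 inner_complex_2 hopf_components by algebra
  then show ?thesis by (rule power2_eq_imp_eq) simp_all
qed

text \<open>Polarizing \<open>\<bar>hopf p\<bar>\<^sup>2 = \<bar>p\<bar>\<^sup>4\<close> gives this identity. It relates the radial component of the second
  derivative of the Hopf map to its differential, and is what turns the Hessian of the pullback
  into the pullback of the Hessian.\<close>

lemma hopf_polar_gauss:
  "hopf p \<bullet> hopf_polar u v + 2 * (hopf_polar p u \<bullet> hopf_polar p v)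
    = (p \<bullet> p) * (u \<bullet> v) + 2 * (p \<bullet> u) * (p \<bullet> v)"
  unfolding inner_3 inner_complex_2 hopf_components hopf_polar_components by algebra

text \<open>At a unit vector the differential doubles the length of vectors orthogonal to \<open>p\<close> and \<open>\<i> p\<close>.\<close>

lemma inner_hopf_polar:
  "hopf_polar p v \<bullet> hopf_polar p v = (p \<bullet> p) * (v \<bullet> v) - (v \<bullet> (\<i> *s p))^2"
  unfolding inner_3 inner_complex_2 hopf_polar_components vector_smult_component by simp algebra

lemma hopf_polar_vertical: "hopf_polar p (\<i> *s p) = 0"
  by (simp add: vec_eq_3 hopf_polar_components)

lemma inner_vertical: "p \<bullet> (\<i> *s p) = 0" for p :: "complex^2"
  by (simp add: inner_complex_2 algebra_simps)

text \<open>By \<open>inner_hopf_polar\<close> equality holds in the Cauchy-Schwarz inequality for \<open>v\<close> and the unit vector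
  \<open>\<i> p\<close>.\<close>

lemma hopf_polar_eq_0:
  assumes "norm p = 1" "hopf_polar p v = 0"
  shows "\<exists>t. v = t *\<^sub>R (\<i> *s p)"
proof -
  let ?w = "\<i> *s p" and ?t = "v \<bullet> (\<i> *s p)"
  have p: "p \<bullet> p = 1" using assms by (simp add: norm_eq_sqrt_inner)
  have w: "?w \<bullet> ?w = 1" using p by (simp add: inner_complex_2)
  have v: "v \<bullet> v = ?t^2" using inner_hopf_polar[of p v] assms(2) p by simp
  have "(v - ?t *\<^sub>R ?w) \<bullet> (v - ?t *\<^sub>R ?w) = 0"
    using v w by (simp add: inner_diff_left inner_diff_right inner_commute power2_eq_square)
  then show ?thesis by (metis inner_eq_zero_iff right_minus_eq)
qed

text \<open>Half of the Pauli matrix combination with coefficients \<open>x\<close>, applied to \<open>p\<close>. The anticommutation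
  of the Pauli matrices makes it a preimage of \<open>x\<close> under the differential of the Hopf map at a unit
  vector \<open>p\<close>.\<close>

definition horizontal_lift :: "complex^2 \<Rightarrow> real^3 \<Rightarrow> complex^2" where
  "horizontal_lift p x = (1/2) *\<^sub>R vector [Complex (x$1) (x$2) * p$2 + of_real (x$3) * p$1,
      Complex (x$1) (- x$2) * p$1 - of_real (x$3) * p$2]"

lemma horizontal_lift:
  assumes "norm p = 1"
  shows "2 *\<^sub>R hopf_polar p (horizontal_lift p x) = x" "p \<bullet> horizontal_lift p x = (hopf p \<bullet> x) / 2"
proof -
  have n: "Re (p$1)^2 + Im (p$1)^2 + Re (p$2)^2 + Im (p$2)^2 = 1"
    using norm_complex_2[of p] assms by (simp add: cmod_power2)
  have c: "Re (horizontal_lift p x $ 1) = (x$1 * Re (p$2) - x$2 * Im (p$2) + x$3 * Re (p$1)) / 2"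
    "Im (horizontal_lift p x $ 1) = (x$1 * Im (p$2) + x$2 * Re (p$2) + x$3 * Im (p$1)) / 2"
    "Re (horizontal_lift p x $ 2) = (x$1 * Re (p$1) + x$2 * Im (p$1) - x$3 * Re (p$2)) / 2"
    "Im (horizontal_lift p x $ 2) = (x$1 * Im (p$1) - x$2 * Re (p$1) - x$3 * Im (p$2)) / 2"
    by (simp_all add: horizontal_lift_def)
  show "2 *\<^sub>R hopf_polar p (horizontal_lift p x) = x"
    unfolding vec_eq_3 vector_scaleR_component hopf_polar_components c
    using n by (intro conjI; simp add: field_simps; algebra)
  show "p \<bullet> horizontal_lift p x = (hopf p \<bullet> x) / 2"
    unfolding inner_3 inner_complex_2 hopf_components c by (simp add: field_simps) algebra
qed

lemma hopf_smult: "cmod z = 1 \<Longrightarrow> hopf (z *s p) = hopf p"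
  using cmod_power2[of z] by (simp add: vec_eq_3 hopf_components) algebra

text \<open>The scalar is the Hermitian product of the two vectors.\<close>

lemma hopf_fiber:
  assumes "norm p = 1" "norm q = 1" "hopf p = hopf q"
  shows "\<exists>z. cmod z = 1 \<and> q = z *s p"
proof -
  have n: "cmod (p$1)^2 + cmod (p$2)^2 = 1" "cmod (q$1)^2 + cmod (q$2)^2 = 1"
    using norm_complex_2[of p] norm_complex_2[of q] assms by auto
  have "cmod (p$1)^2 - cmod (p$2)^2 = cmod (q$1)^2 - cmod (q$2)^2"
    using arg_cong[OF assms(3), of "\<lambda>x. x$3"] by (simp add: hopf_def)
  then have c: "cmod (p$1)^2 = cmod (q$1)^2" "cmod (p$2)^2 = cmod (q$2)^2" using n by linarith+
  have m: "p$1 * cnj (p$2) = q$1 * cnj (q$2)"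
    using arg_cong[OF assms(3), of "\<lambda>x. x$1"] arg_cong[OF assms(3), of "\<lambda>x. x$2"]
    by (simp add: hopf_def complex_eq_iff)
  have m': "p$2 * cnj (p$1) = q$2 * cnj (q$1)"
    using arg_cong[OF m, of cnj] by (simp add: mult.commute)
  have pp: "p$1 * cnj (p$1) = q$1 * cnj (q$1)" "p$2 * cnj (p$2) = q$2 * cnj (q$2)"
    using c by (simp_all add: complex_norm_square[symmetric] del: of_real_power)
  have qq: "q$1 * cnj (q$1) + q$2 * cnj (q$2) = 1"
    using n(2) by (simp add: complex_norm_square[symmetric] flip: of_real_add of_real_power)
  define z where "z = q$1 * cnj (p$1) + q$2 * cnj (p$2)"
  have "z * p$1 = q$1" "z * p$2 = q$2"
    unfolding z_def using m m' pp qq by algebra+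
  then have q: "q = z *s p" by (simp add: vec_eq_2)
  then have "cmod z = 1" using assms by (simp add: norm_vector_smult)
  then show ?thesis using q by blast
qed

lemma hopf_surj: "\<exists>p. hopf p = x"
proof -
  define r where "r = norm x"
  have r2: "r^2 = x$1^2 + x$2^2 + x$3^2"
    unfolding r_def power2_norm_eq_inner by (simp add: inner_3 power2_eq_square)
  have r0: "r \<ge> 0" by (simp add: r_def)
  have "x$3^2 \<le> r^2" using r2 by simp
  then have "\<bar>x$3\<bar> \<le> r" using r0 abs_le_square_iff[of "x$3" r] by simp
  then consider "r + x$3 = 0" | "r + x$3 > 0" by linarith
  then show ?thesis
  proof cases
    case 1
    then have "x$1^2 + x$2^2 = 0" using r2 by (simp add: add_eq_0_iff2)
    then have "x$1 = 0" "x$2 = 0" by (simp_all add: sum_power2_eq_zero_iff)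
    then have "hopf (vector [0, of_real (sqrt r)]) = x"
      using 1 r0 by (simp add: vec_eq_3 hopf_components)
    then show ?thesis by blast
  next
    case 2
    define a where "a = sqrt ((r + x$3) / 2)"
    have a: "a > 0" "a^2 = (r + x$3) / 2" using 2 by (simp_all add: a_def)
    have "hopf (vector [of_real a, Complex (x$1 / (2*a)) (- x$2 / (2*a))]) = x"
    proof -
      have "x$1^2 + x$2^2 = (r - x$3) * (r + x$3)"
        using r2 by (simp add: algebra_simps power2_eq_square)
      also have "r + x$3 = 2 * a^2" using a by simp
      finally have h: "(x$1^2 + x$2^2) / (4 * a^2) = (r - x$3) / 2" using a(1) by simp
      have "a^2 - (x$1^2 + x$2^2) / (4 * a^2) = x$3"
        by (subst h, subst a(2)) (simp add: field_simps)
      then have "a^2 - x$1^2 / (4 * a^2) - x$2^2 / (4 * a^2) = x$3"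
        unfolding add_divide_distrib by (simp only: diff_diff_eq)
      then show ?thesis
        using a(1) by (simp add: vec_eq_3 hopf_components power_divide power_mult_distrib)
    qed
    then show ?thesis by blast
  qed
qed

section \<open>The double cover of the rotation group\<close>

definition su2 :: "complex \<Rightarrow> complex \<Rightarrow> complex^2^2" where
  "su2 a b = vector [vector [a, b], vector [- cnj b, cnj a]]"

lemma matrix_vector_2:
  "(A *v x) $ i = A$i$1 * x$1 + A$i$2 * x$2" for A :: "complex^2^'n"
  by (simp add: matrix_vector_mult_def sum_2)

lemma su2_components [simp]:
  "(su2 a b *v p) $ 1 = a * p$1 + b * p$2" "(su2 a b *v p) $ 2 = - cnj b * p$1 + cnj a * p$2"
  by (simp_all add: matrix_vector_2 su2_def)

lemma su2_in_SU2:
  assumes "cmod a ^ 2 + cmod b ^ 2 = 1" shows "su2 a b \<in> SU2"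
proof -
  have "a * cnj a + b * cnj b = 1"
    using assms by (metis complex_norm_square of_real_1 of_real_add of_real_power)
  then show ?thesis
    by (simp add: SU2_def su2_def conj_transpose_def vec_eq_2 matrix_matrix_mult_def sum_2 det_2
        mat_def mult.commute add.commute)
qed

lemma SU2_cases:
  assumes "A \<in> SU2"
  obtains a b where "A = su2 a b" "cmod a ^ 2 + cmod b ^ 2 = 1"
proof -
  define a b c d where abcd: "a = A$1$1" "b = A$1$2" "c = A$2$1" "d = A$2$2"
  have m: "A ** conj_transpose A = mat 1" and det: "det A = 1" using assms by (auto simp: SU2_def)
  have 1: "a * cnj a + b * cnj b = 1" and 2: "c * cnj a + d * cnj b = 0"
    using arg_cong[OF m, of "\<lambda>M. M$1$1"] arg_cong[OF m, of "\<lambda>M. M$2$1"]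
    by (simp_all add: matrix_matrix_mult_def sum_2 conj_transpose_def mat_def abcd)
  have 3: "a * d - b * c = 1" using det by (simp add: det_2 abcd)
  have "c = - cnj b" "d = cnj a" using 1 2 3 by algebra+
  then have A: "A = su2 a b" by (simp add: vec_eq_2 su2_def abcd)
  have "of_real (cmod a ^ 2 + cmod b ^ 2) = (of_real 1 :: complex)"
    unfolding of_real_add complex_norm_square using 1 by simp
  then have "cmod a ^ 2 + cmod b ^ 2 = 1" unfolding of_real_eq_iff .
  with A show thesis by (rule that)
qed

lemma SU2_mat_1: "mat 1 \<in> SU2"
proof -
  have "mat 1 = su2 1 0" by (simp add: su2_def mat_def vec_eq_2)
  then show ?thesis by (simp add: su2_in_SU2)
qed

lemma conj_transpose_mult: "conj_transpose (A ** B) = conj_transpose B ** conj_transpose A"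
  by (simp add: conj_transpose_def matrix_matrix_mult_def vec_eq_iff mult.commute)

lemma SU2_conj_transpose_mult:
  assumes "A \<in> SU2"
  shows "A ** conj_transpose A = mat 1" "conj_transpose A ** A = mat 1"
    "A *v (conj_transpose A *v p) = p" "conj_transpose A *v (A *v p) = p"
proof -
  show 1: "A ** conj_transpose A = mat 1" using assms by (simp add: SU2_def)
  then show 2: "conj_transpose A ** A = mat 1" by (simp add: matrix_left_right_inverse)
  show "A *v (conj_transpose A *v p) = p" "conj_transpose A *v (A *v p) = p"
    by (simp_all add: 1 2 matrix_vector_mul_assoc)
qed

lemma SU2_mult:
  assumes "A \<in> SU2" "B \<in> SU2" shows "A ** B \<in> SU2"
proof -
  have "(A ** B) ** conj_transpose (A ** B) = A ** (B ** conj_transpose B) ** conj_transpose A"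
    by (simp add: conj_transpose_mult matrix_mul_assoc)
  also have "\<dots> = mat 1" using assms by (simp add: SU2_conj_transpose_mult)
  finally show ?thesis using assms by (simp add: SU2_def det_mul)
qed

lemma SU2_conj_transpose:
  assumes "A \<in> SU2" shows "conj_transpose A \<in> SU2"
proof -
  obtain a b where "A = su2 a b" "cmod a ^ 2 + cmod b ^ 2 = 1" using assms by (rule SU2_cases)
  moreover from this have "conj_transpose A = su2 (cnj a) (- b)"
    by (simp add: su2_def conj_transpose_def vec_eq_2)
  ultimately show ?thesis by (simp add: su2_in_SU2)
qed

lemma SU2_norm:
  assumes "A \<in> SU2" shows "norm (A *v p) = norm p"
proof -
  obtain a b where A: "A = su2 a b" and ab: "cmod a ^ 2 + cmod b ^ 2 = 1" using assms by (rule SU2_cases)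
  have "norm (A *v p) ^ 2 = (cmod a ^ 2 + cmod b ^ 2) * norm p ^ 2"
    unfolding A norm_complex_2 su2_components cmod_power2 by simp algebra
  then show ?thesis using ab by simp
qed

lemma SU2_smult: "A *v (z *s p) = z *s (A *v p)" for A :: "complex^2^2"
  by (simp add: vec_eq_2 matrix_vector_2 algebra_simps)

text \<open>The entries are read off from \<open>hopf (su2 a b *v p)\<close>, whose first two coordinates \<open>x + \<i> y\<close> become
  \<open>a\<^sup>2 (x + \<i> y) - b\<^sup>2 (x - \<i> y) - 2 a b z\<close>.\<close>

definition su2_rotation :: "complex \<Rightarrow> complex \<Rightarrow> real^3^3" where
  "su2_rotation a b = mat3 (Re (a^2 - b^2)) (- Im (a^2 + b^2)) (- 2 * Re (a * b))
     (Im (a^2 - b^2)) (Re (a^2 + b^2)) (- 2 * Im (a * b))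
     (2 * Re (a * cnj b)) (- 2 * Im (a * cnj b)) (cmod a ^ 2 - cmod b ^ 2)"

lemma su2_rotation_in_SO3:
  assumes "cmod a ^ 2 + cmod b ^ 2 = 1" shows "su2_rotation a b \<in> SO3"
proof -
  define a1 a2 b1 b2 where c: "a1 = Re a" "a2 = Im a" "b1 = Re b" "b2 = Im b"
  have n: "a1^2 + a2^2 + b1^2 + b2^2 = 1" using assms by (simp add: cmod_power2 c)
  have "su2_rotation a b = mat3 (a1^2 - a2^2 - b1^2 + b2^2) (- (2 * (a1 * a2 + b1 * b2))) (- (2 * (a1 * b1 - a2 * b2)))
     (2 * (a1 * a2 - b1 * b2)) (a1^2 - a2^2 + b1^2 - b2^2) (- (2 * (a1 * b2 + a2 * b1)))
     (2 * (a1 * b1 + a2 * b2)) (- (2 * (a2 * b1 - a1 * b2))) (a1^2 + a2^2 - b1^2 - b2^2)"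
    unfolding su2_rotation_def c cmod_power2 by (simp add: power2_eq_square algebra_simps)
  also have "\<dots> \<in> SO3"
    apply (rule mat3_SO3I)
    subgoal using n by algebra
    subgoal using n by algebra
    subgoal using n by algebra
    subgoal by (simp add: power2_eq_square algebra_simps)
    subgoal by (simp add: power2_eq_square algebra_simps)
    subgoal by (simp add: power2_eq_square algebra_simps)
    subgoal using n by algebra
    done
  finally show ?thesis .
qed

lemma covers_su2:
  assumes "cmod a ^ 2 + cmod b ^ 2 = 1" shows "covers (su2 a b) (su2_rotation a b)"
proof -
  have "hopf (su2 a b *v p) = su2_rotation a b *v hopf p" for p
    unfolding vec_eq_3 hopf_components su2_components su2_rotation_def mat3_mult_vec cmod_power2
    by (intro conjI; simp add: power2_eq_square; algebra)
  then show ?thesis using assms by (simp add: covers_def su2_in_SU2 su2_rotation_in_SO3)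
qed

lemma SU2_covers:
  assumes "A \<in> SU2" obtains R where "covers A R"
  using assms covers_su2 by (metis SU2_cases)

lemma covers_unique: "covers A R \<Longrightarrow> covers A R' \<Longrightarrow> R = R'"
  by (metis covers_def hopf_surj matrix_eq)

lemma covers_mult: "covers A R \<Longrightarrow> covers B T \<Longrightarrow> covers (A ** B) (R ** T)"
  by (simp add: covers_def SU2_mult SO3_mult flip: matrix_vector_mul_assoc)

lemma covers_conj_transpose: "covers A R \<Longrightarrow> covers (conj_transpose A) (transpose R)"
  by (auto simp: covers_def SO3_transpose SU2_conj_transpose)
    (metis SO3_transpose_mult(3) SU2_conj_transpose_mult(3))

lemma SU2_first_column:
  assumes "norm p = 1" obtains U where "U \<in> SU2" "U *v vector [1, 0] = p"
proof (rule that)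
  show "su2 (p$1) (- cnj (p$2)) \<in> SU2"
    using norm_complex_2[of p] assms by (intro su2_in_SU2) simp
  show "su2 (p$1) (- cnj (p$2)) *v vector [1, 0] = p" by (simp add: vec_eq_2)
qed

lemma hopf_pole: "hopf (vector [1, 0]) = vector [0, 0, 1]"
  by (simp add: vec_eq_3 hopf_components)

text \<open>In dimension three \<open>det (R - 1) = det (R\<^sup>T - 1) = det (1 - R) = - det (R - 1)\<close> for a rotation, so 1
  is an eigenvalue.\<close>

lemma SO3_axis:
  assumes "R \<in> SO3" obtains x where "norm x = 1" "R *v x = x"
proof -
  have RR: "R ** transpose R = mat 1" and d: "det R = 1"
    using assms by (auto simp: SO3_def orthogonal_matrix_def)
  have "R ** (transpose R - mat 1) = mat 1 - R"
    by (simp add: matrix_eq matrix_vector_mult_diff_rdistrib matrix_vector_mult_diff_distrib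
        SO3_transpose_mult[OF assms] flip: matrix_vector_mul_assoc)
  then have "det (transpose R - mat 1) = det (mat 1 - R)"
    using d by (metis det_mul mult_1)
  moreover have "transpose R - mat 1 = transpose (R - mat 1)"
    by (simp add: transpose_def mat_def vec_eq_iff)
  moreover have "det (mat 1 - R) = - det (R - mat 1)"
    by (simp add: det_3 algebra_simps)
  ultimately have "det (R - mat 1) = 0" by (simp add: det_transpose)
  then have "\<not> invertible (R - mat 1)" by (simp add: invertible_det_nz)
  then obtain y where y: "(R - mat 1) *v y = 0" "y \<noteq> 0"
    unfolding invertible_left_inverse matrix_left_invertible_ker by blast
  then have "R *v y = y" by (simp add: matrix_vector_mult_diff_rdistrib)
  then show thesis
    using y(2) by (intro that[of "y /\<^sub>R norm y"]) (simp_all add: matrix_vector_mult_scaleR)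
qed

lemma SO3_conjugate:
  assumes "S \<in> SO3"
  shows "S ** (transpose S ** R ** S) ** transpose S = R" "transpose S ** (S ** R ** transpose S) ** S = R"
    "S ** (R ** T) ** transpose S = (S ** R ** transpose S) ** (S ** T ** transpose S)"
  by (simp_all add: matrix_eq SO3_transpose_mult[OF assms] flip: matrix_vector_mul_assoc)

text \<open>Move \<open>p\<close> to the first basis vector. A matrix in \<open>SU(2)\<close> is determined by its first column.\<close>

lemma SU2_eqI:
  assumes A: "A \<in> SU2" "B \<in> SU2" and p: "norm p = 1" and eq: "A *v p = B *v p"
  shows "A = B"
proof -
  obtain U where U: "U \<in> SU2" "U *v vector [1, 0] = p" using SU2_first_column[OF p] .
  define C where "C = conj_transpose U ** (conj_transpose B ** A) ** U"
  have "C \<in> SU2" using A U by (simp add: C_def SU2_mult SU2_conj_transpose)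
  then obtain a b where C: "C = su2 a b" by (rule SU2_cases)
  have "C *v vector [1, 0] = conj_transpose U *v (conj_transpose B *v (A *v p))"
    using U by (simp add: C_def flip: matrix_vector_mul_assoc)
  also have "\<dots> = conj_transpose U *v (U *v vector [1, 0])"
    by (simp add: eq SU2_conj_transpose_mult A U)
  also have "\<dots> = vector [1, 0]" using U(1) by (simp add: SU2_conj_transpose_mult)
  finally have "a = 1" "b = 0" by (simp_all add: C vec_eq_2)
  then have C1: "C = mat 1" by (simp add: C su2_def mat_def vec_eq_2)
  have "B ** (U ** C ** conj_transpose U) = (B ** (U ** conj_transpose U) ** conj_transpose B) ** A ** (U ** conj_transpose U)"
    by (simp add: C_def matrix_mul_assoc)
  then show ?thesis using A U by (simp add: C1 SU2_conj_transpose_mult)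
qed

lemma covers_mat_1:
  assumes "covers A (mat 1)" shows "A = mat 1 \<or> A = - mat 1"
proof -
  obtain a b where A: "A = su2 a b" and ab: "cmod a ^ 2 + cmod b ^ 2 = 1"
    using assms by (auto simp: covers_def elim: SU2_cases)
  have R: "su2_rotation a b = mat 1"
    using covers_unique assms covers_su2[OF ab] A by blast
  have "cmod a ^ 2 - cmod b ^ 2 = 1" "Re (a^2 - b^2) = 1"
    using arg_cong[OF R, of "\<lambda>M. M$3$3"] arg_cong[OF R, of "\<lambda>M. M$1$1"]
    by (simp_all add: su2_rotation_def mat3_def mat_def)
  then have "cmod b ^ 2 = 0" "cmod a ^ 2 = 1" using ab by linarith+
  with \<open>Re (a^2 - b^2) = 1\<close> have b: "b = 0" and "cmod a ^ 2 = 1" "Re (a^2) = 1" by simp_all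
  then have "Re a ^ 2 + Im a ^ 2 = 1" "Re a ^ 2 - Im a ^ 2 = 1"
    using cmod_power2[of a] by (simp_all add: power2_eq_square)
  then have "Im a ^ 2 = 0" "Re a ^ 2 = 1" by linarith+
  then have "a = 1 \<or> a = -1" by (auto simp: complex_eq_iff power2_eq_1_iff)
  then show ?thesis using A b by (auto simp: su2_def mat_def vec_eq_2)
qed

lemma covers_uminus: "covers A R \<Longrightarrow> covers (- A) R"
proof -
  assume A: "covers A R"
  have m: "- A *v p = - (A *v p)" for p by (simp add: vec_eq_2 matrix_vector_2)
  have "hopf (- q) = hopf q" for q by (simp add: vec_eq_3 hopf_components)
  moreover have "- A \<in> SU2"
  proof -
    have "- A ** conj_transpose (- A) = A ** conj_transpose A"
      by (simp add: conj_transpose_def matrix_matrix_mult_def sum_2 vec_eq_iff)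
    then show ?thesis using A by (simp add: covers_def SU2_def det_2)
  qed
  ultimately show ?thesis using A by (simp add: covers_def m)
qed

text \<open>Conjugating by a lift that moves the axis of \<open>R\<close> to the pole leaves a rotation about the pole. It
  is covered by a diagonal matrix whose entry is a square root of the rotation number.\<close>

lemma SO3_covered:
  assumes R: "R \<in> SO3" obtains A where "covers A R"
proof -
  obtain x where x: "norm x = 1" "R *v x = x" using SO3_axis[OF R] .
  obtain p where p: "hopf p = x" using hopf_surj by blast
  then have "norm p ^ 2 = 1" using norm_hopf[of p] x by simp
  then have "norm p = 1" by (metis abs_norm_cancel abs_1 power2_eq_1_iff abs_minus_cancel)
  then obtain U where U: "U \<in> SU2" "U *v vector [1, 0] = p" by (rule SU2_first_column)
  obtain T where T: "covers U T" using U(1) by (rule SU2_covers)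
  have T': "T \<in> SO3" using T by (simp add: covers_def)
  let ?e1 = "vector [1, 0, 0] :: real^3" and ?e3 = "vector [0, 0, 1] :: real^3"
  have Te: "T *v ?e3 = x"
    using T U p by (metis covers_def hopf_pole)
  define Z where "Z = transpose T ** R ** T"
  have Z: "Z \<in> SO3" using T' R by (simp add: Z_def SO3_mult SO3_transpose)
  have Ze3: "Z *v ?e3 = ?e3"
    using SO3_transpose_mult(3)[OF T', of ?e3] by (simp add: Z_def Te x flip: matrix_vector_mul_assoc)
  define y where "y = Z *v ?e1"
  have y3: "y$3 = 0" using SO3_inner[OF Z, of ?e1 ?e3] by (simp add: Ze3 inner_3 flip: y_def)
  then have y12: "y$1^2 + y$2^2 = 1"
    using SO3_inner[OF Z, of ?e1 ?e1] by (simp add: inner_3 power2_eq_square flip: y_def)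
  define z where "z = csqrt (Complex (y$1) (y$2))"
  have z2: "z^2 = Complex (y$1) (y$2)" by (simp add: z_def)
  have "cmod (z^2) = 1" unfolding z2 using y12 by (simp add: cmod_def)
  then have "cmod z ^ 2 = 1" by (simp add: norm_power)
  then have z: "cmod z ^ 2 + cmod 0 ^ 2 = 1" by simp
  have "su2_rotation z 0 = Z"
  proof (rule SO3_eqI[of _ _ ?e3 ?e1])
    show "su2_rotation z 0 *v ?e3 = Z *v ?e3"
      unfolding Ze3 using z by (simp add: su2_rotation_def vec_eq_3)
    show "su2_rotation z 0 *v ?e1 = Z *v ?e1"
      unfolding y_def[symmetric] by (simp add: su2_rotation_def vec_eq_3 z2 y3)
  qed (simp_all add: Z su2_rotation_in_SO3[OF z] cross3_def vec_eq_3)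
  then have "covers (su2 z 0) Z" using covers_su2[OF z] by simp
  then have "covers (U ** su2 z 0 ** conj_transpose U) (T ** Z ** transpose T)"
    using T by (intro covers_mult covers_conj_transpose)
  moreover have "T ** Z ** transpose T = (T ** transpose T) ** R ** (T ** transpose T)"
    by (simp add: Z_def matrix_mul_assoc)
  ultimately show thesis using that by (simp add: SO3_transpose_mult[OF T'])
qed

text \<open>Multiplication by \<open>z\<close> permutes \<open>L\<close>, so the product of all elements does not change when it is
  multiplied by \<open>z\<^sup>n\<close>. Thus \<open>L\<close> consists of \<open>n\<close>-th roots of unity, and there are only \<open>n\<close> of these.\<close>

lemma finite_group_eq_roots_of_unity:
  fixes L :: "complex set"
  assumes fin: "finite L" and n: "card L = n" "n > 0" and nz: "0 \<notin> L"
    and mult: "\<And>z w. z \<in> L \<Longrightarrow> w \<in> L \<Longrightarrow> z * w \<in> L"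
  shows "L = {z. z ^ n = 1}"
proof (rule card_subset_eq)
  show "finite {z::complex. z ^ n = 1}" using n by (intro finite_roots_unity) auto
  show "card L = card {z::complex. z ^ n = 1}" using n by (simp add: card_roots_unity_eq)
  show "L \<subseteq> {z. z ^ n = 1}"
  proof
    fix z assume z: "z \<in> L"
    have inj: "inj_on ((*) z) L" using z nz by (intro inj_onI) auto
    then have "(*) z ` L = L" using mult z fin by (intro endo_inj_surj) auto
    then have "(\<Prod>w\<in>L. w) = (\<Prod>w\<in>L. z * w)"
      using prod.reindex[OF inj, of "\<lambda>w. w"] by simp
    also have "\<dots> = z ^ n * (\<Prod>w\<in>L. w)" by (simp add: prod.distrib n)
    finally show "z \<in> {z. z ^ n = 1}" using nz fin by (auto simp: prod_zero_iff)
  qed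
qed

section \<open>Binary icosahedral groups in arbitrary position\<close>

text \<open>A conjugate of the binary icosahedral group is the full preimage in \<open>SU(2)\<close> of a rotated copy of the
  icosahedral group. The rotation \<open>S\<close> carries this copy back to standard position.\<close>

locale rotated_icosahedron =
  fixes S :: "real^3^3" and I :: "(complex^2^2) set"
  assumes S: "S \<in> SO3"
    and I: "A \<in> I \<longleftrightarrow> (\<exists>R. covers A R \<and> S ** R ** transpose S \<in> icosahedral_rotations)"
begin

text \<open>The Hopf map followed by the rotation into standard position, so that orbits of \<open>I\<close> in \<open>S\<^sup>3\<close> lie
  over orbits of the standard icosahedral group.\<close>

definition base :: "complex^2 \<Rightarrow> real^3" where "base p = S *v hopf p"

lemma norm_base: "norm (base p) = norm p ^ 2"
  by (simp add: base_def SO3_norm S norm_hopf)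

lemma base_eq_iff: "base p = base q \<longleftrightarrow> hopf p = hopf q"
  by (simp add: base_def SO3_inj S)

lemma I_SU2: "A \<in> I \<Longrightarrow> A \<in> SU2"
  by (auto simp: I covers_def)

lemma covers_base:
  assumes "covers A R" shows "base (A *v p) = (S ** R ** transpose S) *v base p"
  using assms
  by (simp add: base_def covers_def SO3_transpose_mult[OF S] flip: matrix_vector_mul_assoc)

lemma I_base:
  assumes "A \<in> I" obtains R where "R \<in> icosahedral_rotations" "\<And>p. base (A *v p) = R *v base p"
  using assms covers_base unfolding I by metis

lemma covered_rotation:
  assumes R: "R \<in> icosahedral_rotations"
  obtains A where "A \<in> I" "covers A (transpose S ** R ** S)" "\<And>p. base (A *v p) = R *v base p"
proof -
  have e: "S ** (transpose S ** R ** S) ** transpose S = R"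
    by (rule SO3_conjugate(1)[OF S])
  have "transpose S ** R ** S \<in> SO3"
    using R by (simp add: SO3_mult SO3_transpose S icosahedral_SO3)
  then obtain A where A: "covers A (transpose S ** R ** S)" by (rule SO3_covered)
  show thesis
  proof (rule that[OF _ A])
    show "A \<in> I" unfolding I using A e R by (intro exI[of _ "transpose S ** R ** S"]) simp
    show "base (A *v p) = R *v base p" for p using covers_base[OF A] by (simp add: e)
  qed
qed

lemma I_mat_1: "mat 1 \<in> I"
proof -
  have "covers (mat 1) (mat 1)" by (simp add: covers_def SU2_mat_1 SO3_mat_1)
  then show ?thesis unfolding I
    by (intro exI[of _ "mat 1"]) (simp add: SO3_transpose_mult S icosahedral_mat_1)
qed

lemma I_mult:
  assumes "A \<in> I" "B \<in> I" shows "A ** B \<in> I"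
proof -
  obtain R T where RT: "covers A R" "S ** R ** transpose S \<in> icosahedral_rotations"
    "covers B T" "S ** T ** transpose S \<in> icosahedral_rotations"
    using assms by (auto simp: I)
  show ?thesis unfolding I
    using RT SO3_conjugate(3)[OF S, of R T] covers_mult[of A R B T] icosahedral_mult
    by (intro exI[of _ "R ** T"]) simp
qed

lemma I_conj_transpose:
  assumes "A \<in> I" shows "conj_transpose A \<in> I"
proof -
  obtain R where R: "covers A R" "S ** R ** transpose S \<in> icosahedral_rotations"
    using assms by (auto simp: I)
  have "S ** transpose R ** transpose S = transpose (S ** R ** transpose S)"
    by (simp add: matrix_transpose_mul matrix_mul_assoc)
  then show ?thesis unfolding I
    using R by (intro exI[of _ "transpose R"]) (simp add: covers_conj_transpose icosahedral_transpose)
qed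

lemma orbit_eq_iff: "orbit I p = orbit I q \<longleftrightarrow> (\<exists>A\<in>I. q = A *v p)"
proof
  assume "orbit I p = orbit I q"
  moreover have "q \<in> orbit I q" using I_mat_1 by (force simp: orbit_def)
  ultimately show "\<exists>A\<in>I. q = A *v p" by (auto simp: orbit_def)
next
  have sub: "orbit I (A *v p) \<subseteq> orbit I p" if "A \<in> I" for A p
    using that I_mult by (auto simp: orbit_def matrix_vector_mul_assoc)
  assume "\<exists>A\<in>I. q = A *v p"
  then obtain A where A: "A \<in> I" "q = A *v p" by blast
  then have "p = conj_transpose A *v q" by (simp add: SU2_conj_transpose_mult I_SU2)
  then have "orbit I p \<subseteq> orbit I q" using sub[OF I_conj_transpose[OF A(1)], of q] by simp
  then show "orbit I p = orbit I q" using sub[OF A(1), of p] A(2) by blast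
qed

lemma orbifold_order_hopf: "orbifold_order I (hopf p) = card (stabilizer (base p))"
proof -
  have img: "R \<in> rotation_image I \<longleftrightarrow> R \<in> SO3 \<and> S ** R ** transpose S \<in> icosahedral_rotations" for R
  proof
    assume "R \<in> rotation_image I"
    then obtain A T where "covers A R" "covers A T" "S ** T ** transpose S \<in> icosahedral_rotations"
      by (auto simp: rotation_image_def I)
    then show "R \<in> SO3 \<and> S ** R ** transpose S \<in> icosahedral_rotations"
      using covers_unique[of A R T] by (auto simp: covers_def)
  next
    assume R: "R \<in> SO3 \<and> S ** R ** transpose S \<in> icosahedral_rotations"
    then obtain A where "covers A R" using SO3_covered by blast
    then show "R \<in> rotation_image I" using R I unfolding rotation_image_def by blast
  qed
  show ?thesis unfolding orbifold_order_def
  proof (rule bij_betw_same_card[of "\<lambda>R. S ** R ** transpose S"],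
      rule bij_betw_byWitness[where f' = "\<lambda>R. transpose S ** R ** S"])
    show "\<forall>R\<in>{R \<in> rotation_image I. R *v hopf p = hopf p}. transpose S ** (S ** R ** transpose S) ** S = R"
      by (simp add: SO3_conjugate[OF S])
    have cancel: "S ** (transpose S ** R ** S) ** transpose S = R" for R
      by (rule SO3_conjugate(1)[OF S])
    then show "\<forall>R\<in>stabilizer (base p). S ** (transpose S ** R ** S) ** transpose S = R" by blast
    show "(\<lambda>R. S ** R ** transpose S) ` {R \<in> rotation_image I. R *v hopf p = hopf p} \<subseteq> stabilizer (base p)"
      by (auto simp: img stabilizer_def base_def SO3_transpose_mult[OF S] simp flip: matrix_vector_mul_assoc)
    show "(\<lambda>R. transpose S ** R ** S) ` stabilizer (base p) \<subseteq> {R \<in> rotation_image I. R *v hopf p = hopf p}"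
      by (auto simp: img cancel stabilizer_def base_def SO3_mult SO3_transpose S icosahedral_SO3)
        (simp add: SO3_transpose_mult[OF S] flip: matrix_vector_mul_assoc)
  qed
qed

text \<open>The scalars \<open>z\<close> form a group \<open>K\<close>. Over each rotation \<open>R\<close> in the isotropy group of \<open>base p\<close> there
  are exactly two of them, one for each of the two lifts of \<open>R\<close>, and these differ by a sign. Hence \<open>K\<close>
  has order \<open>2 m\<close>.\<close>

lemma fiber_rotations:
  assumes p: "norm p = 1" and m: "card (stabilizer (base p)) = m" "m > 0"
  shows "(\<exists>A\<in>I. A *v p = z *s p) \<longleftrightarrow> z ^ (2 * m) = 1"
proof -
  define L where "L R = {z. \<exists>A. covers A (transpose S ** R ** S) \<and> A *v p = z *s p}" for R
  define K where "K = {z. \<exists>A\<in>I. A *v p = z *s p}"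
  have pnz: "z *s p = w *s p \<longleftrightarrow> z = w" for z w
  proof -
    have "p \<noteq> 0" using p by auto
    then have "p$1 \<noteq> 0 \<or> p$2 \<noteq> 0" by (simp add: vec_eq_2)
    then show ?thesis by (auto simp: vec_eq_2)
  qed
  have unit: "cmod z = 1" if z: "z \<in> K" for z
  proof -
    obtain A where "A \<in> I" "A *v p = z *s p" using z unfolding K_def by blast
    then show ?thesis using SU2_norm[of A p] p by (simp add: I_SU2 norm_vector_smult)
  qed
  have L2: "\<exists>z. z \<noteq> 0 \<and> L R = {z, - z}" if R: "R \<in> stabilizer (base p)" for R
  proof -
    have RI: "R \<in> icosahedral_rotations" "R *v base p = base p" using R by (auto simp: stabilizer_def)
    obtain A where A: "A \<in> I" "covers A (transpose S ** R ** S)" "\<And>p. base (A *v p) = R *v base p"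
      using covered_rotation[OF RI(1)] by metis
    have "hopf p = hopf (A *v p)" using A(3)[of p] RI base_eq_iff by metis
    then obtain z where z: "cmod z = 1" "A *v p = z *s p"
      using hopf_fiber p SU2_norm[OF I_SU2[OF A(1)]] by metis
    have "(- A) *v p = - (A *v p)" by (simp add: vec_eq_2 matrix_vector_2)
    then have "(- A) *v p = (- z) *s p" using z by (simp add: vec_eq_2)
    then have "{z, - z} \<subseteq> L R" using A z covers_uminus by (auto simp: L_def)
    moreover have "w = z \<or> w = - z" if w: "w \<in> L R" for w
    proof -
      obtain B where B: "covers B (transpose S ** R ** S)" "B *v p = w *s p" using w by (auto simp: L_def)
      have "covers (conj_transpose A ** B) (mat 1)"
        using covers_mult[OF covers_conj_transpose[OF A(2)] B(1)] A(2)
        by (simp add: covers_def SO3_transpose_mult)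
      then have "conj_transpose A ** B = mat 1 \<or> conj_transpose A ** B = - mat 1" by (rule covers_mat_1)
      moreover have "A ** (conj_transpose A ** B) = B"
        using I_SU2[OF A(1)] by (simp add: matrix_mul_assoc SU2_conj_transpose_mult)
      ultimately have "B = A \<or> B = A ** (- mat 1)" by auto
      moreover have "(A ** (- mat 1)) *v p = (- A) *v p" for p :: "complex^2"
        by (simp add: vec_eq_2 matrix_vector_2 flip: matrix_vector_mul_assoc)
          (simp add: mat_def)
      ultimately have "w *s p = z *s p \<or> w *s p = (- z) *s p"
        using B z \<open>(- A) *v p = (- z) *s p\<close> by metis
      then show ?thesis unfolding pnz .
    qed
    ultimately have "L R = {z, - z}" by blast
    then show ?thesis using z by (intro exI[of _ z]) auto
  qed
  have KL: "K = (\<Union>R\<in>stabilizer (base p). L R)"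
  proof (intro equalityI subsetI)
    fix z assume z: "z \<in> K"
    then obtain A R where A: "A \<in> I" "A *v p = z *s p" and R: "covers A R"
      "S ** R ** transpose S \<in> icosahedral_rotations" using I unfolding K_def by blast
    have "hopf (z *s p) = hopf p" using unit[OF z] by (rule hopf_smult)
    then have "S ** R ** transpose S \<in> stabilizer (base p)"
      using R A covers_base[OF R(1), of p] by (simp add: stabilizer_def base_def)
    moreover have "transpose S ** (S ** R ** transpose S) ** S = R"
      by (simp add: SO3_conjugate[OF S])
    ultimately show "z \<in> (\<Union>R\<in>stabilizer (base p). L R)"
      using A R by (intro UN_I[of "S ** R ** transpose S"]) (auto simp: L_def)
  next
    fix z assume "z \<in> (\<Union>R\<in>stabilizer (base p). L R)"
    then obtain R A where R: "R \<in> icosahedral_rotations" and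
      A: "covers A (transpose S ** R ** S)" "A *v p = z *s p" by (auto simp: L_def stabilizer_def)
    have "S ** (transpose S ** R ** S) ** transpose S = R"
      by (rule SO3_conjugate(1)[OF S])
    then have "A \<in> I" unfolding I using R A by (intro exI[of _ "transpose S ** R ** S"]) simp
    then show "z \<in> K" using A unfolding K_def by blast
  qed
  have disj: "L R \<inter> L R' = {}" if "R \<noteq> R'" for R R'
  proof (rule ccontr)
    assume "L R \<inter> L R' \<noteq> {}"
    then obtain z A B where "covers A (transpose S ** R ** S)" "A *v p = z *s p"
      "covers B (transpose S ** R' ** S)" "B *v p = z *s p" by (auto simp: L_def)
    then have "transpose S ** R ** S = transpose S ** R' ** S"
      using SU2_eqI[of A B p] p covers_unique by (auto simp: covers_def)
    then have "S ** (transpose S ** R ** S) ** transpose S = S ** (transpose S ** R' ** S) ** transpose S"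
      by simp
    then show False using that unfolding SO3_conjugate(1)[OF S] by blast
  qed
  have fin: "finite (stabilizer (base p))" using m card_gt_0_iff by blast
  have cL: "finite (L R) \<and> card (L R) = 2" if R: "R \<in> stabilizer (base p)" for R
  proof -
    obtain z where z: "z \<noteq> 0" "L R = {z, - z}" using L2[OF R] by blast
    have "z \<noteq> - z" using z(1) by (simp add: eq_neg_iff_add_eq_0)
    then show ?thesis by (simp add: z(2))
  qed
  have "card K = (\<Sum>R\<in>stabilizer (base p). card (L R))"
    unfolding KL using fin cL disj by (intro card_UN_disjoint) auto
  then have "card K = 2 * m" using cL m by simp
  moreover have "finite K" unfolding KL using fin cL by blast
  moreover have "z * w \<in> K" if zw: "z \<in> K" "w \<in> K" for z w
  proof -
    obtain A B where AB: "A \<in> I" "A *v p = z *s p" "B \<in> I" "B *v p = w *s p"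
      using zw unfolding K_def by blast
    have "(A ** B) *v p = w *s (z *s p)"
      using AB by (simp add: SU2_smult flip: matrix_vector_mul_assoc)
    then have "(A ** B) *v p = (z * w) *s p" by (simp add: vec_eq_2)
    then show ?thesis using I_mult[OF AB(1,3)] unfolding K_def by blast
  qed
  moreover have "0 \<notin> K" using unit by force
  ultimately have "K = {z. z ^ (2 * m) = 1}" using m by (intro finite_group_eq_roots_of_unity) auto
  then show ?thesis unfolding K_def by blast
qed

end

section \<open>Lifting the seed to the three-sphere\<close>

lemma has_derivative_inverse_inner:
  fixes q :: "'a::real_inner"
  assumes "q \<noteq> 0"
  shows "((\<lambda>q. inverse (q \<bullet> q)) has_derivative (\<lambda>u. - 2 * (q \<bullet> u) * inverse (q \<bullet> q) ^ 2)) (at q)"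
  using assms
  by (auto intro!: derivative_eq_intros simp: fun_eq_iff inner_commute power2_eq_square)

text \<open>The seed in the form provided by the classification of invariant sextics. On the sphere \<open>\<bar>x\<bar>\<^sup>6\<close> is
  constant, so it only contributes \<open>\<beta>\<close>.\<close>

locale lifted_seed = rotated_icosahedron +
  fixes F :: "(complex^2) set \<Rightarrow> real" and \<alpha> \<beta> :: real
  assumes \<alpha>: "\<alpha> \<noteq> 0"
    and F: "p \<in> S3 \<Longrightarrow> F (orbit I p) = \<alpha> * icosahedral_sextic (base p) + \<beta>"
    and invariant: "R \<in> icosahedral_rotations \<Longrightarrow> icosahedral_sextic (R *v x) = icosahedral_sextic x"
begin

definition base_polar :: "complex^2 \<Rightarrow> complex^2 \<Rightarrow> real^3" where
  "base_polar p q = S *v hopf_polar p q"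

lemma base_polar_self: "base_polar p p = base p"
  by (simp add: base_polar_def base_def hopf_polar_self)

lemma base_polar_commute: "base_polar p q = base_polar q p"
  by (simp add: base_polar_def hopf_polar_commute)

lemma bounded_bilinear_base_polar: "bounded_bilinear base_polar"
  unfolding bilinear_conv_bounded_bilinear[symmetric] bilinear_def base_polar_def
  by (auto intro!: linearI simp: matrix_vector_right_distrib matrix_vector_mult_scaleR
      bounded_bilinear.add_left[OF bounded_bilinear_hopf_polar]
      bounded_bilinear.add_right[OF bounded_bilinear_hopf_polar]
      bounded_bilinear.scaleR_left[OF bounded_bilinear_hopf_polar]
      bounded_bilinear.scaleR_right[OF bounded_bilinear_hopf_polar])

lemma base_scaleR: "base (c *\<^sub>R p) = c^2 *\<^sub>R base p"
  unfolding base_polar_self[symmetric]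
  by (simp add: bounded_bilinear.scaleR_left[OF bounded_bilinear_base_polar]
      bounded_bilinear.scaleR_right[OF bounded_bilinear_base_polar] power2_eq_square)

lemma base_polar_gauss:
  "base p \<bullet> base_polar u v + 2 * (base_polar p u \<bullet> base_polar p v)
    = (p \<bullet> p) * (u \<bullet> v) + 2 * (p \<bullet> u) * (p \<bullet> v)"
  unfolding base_polar_def base_def SO3_inner[OF S] by (rule hopf_polar_gauss)

lemma inner_base_base_polar: "base p \<bullet> base_polar p v = (p \<bullet> p) * (p \<bullet> v)"
  using base_polar_gauss[of p p v] by (simp add: base_polar_self)

lemma tangent_lift:
  assumes p: "norm p = 1" and x: "base p \<bullet> x = 0"
  obtains v where "p \<bullet> v = 0" "2 *\<^sub>R base_polar p v = x"
proof (rule that)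
  let ?v = "horizontal_lift p (transpose S *v x)"
  have "hopf p \<bullet> (transpose S *v x) = base p \<bullet> x"
    unfolding base_def using SO3_inner[OF S, of "hopf p" "transpose S *v x"]
    by (simp add: SO3_transpose_mult[OF S])
  then show "p \<bullet> ?v = 0" using x by (simp add: horizontal_lift(2)[OF p])
  have "2 *\<^sub>R base_polar p ?v = S *v (2 *\<^sub>R hopf_polar p ?v)"
    by (simp add: base_polar_def matrix_vector_mult_scaleR)
  then show "2 *\<^sub>R base_polar p ?v = x"
    by (simp add: horizontal_lift(1)[OF p] SO3_transpose_mult[OF S])
qed

lemma has_derivative_base: "(base has_derivative (\<lambda>u. 2 *\<^sub>R base_polar q u)) (at q)"
proof -
  have "((\<lambda>q. base_polar q q) has_derivative (\<lambda>u. base_polar q u + base_polar u q)) (at q)"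
    by (intro bounded_bilinear.FDERIV[OF bounded_bilinear_base_polar] has_derivative_ident)
  then show ?thesis by (simp add: base_polar_self base_polar_commute[of _ q] scaleR_2)
qed

text \<open>The differential of \<open>\<alpha> G (base q) / \<bar>q\<bar>\<^sup>1\<^sup>2\<close>, the radial extension of the lifted seed up to a
  constant.\<close>

definition seed_differential :: "complex^2 \<Rightarrow> complex^2 \<Rightarrow> real" where
  "seed_differential q u = \<alpha> *
     (sextic_deriv (base q) (2 *\<^sub>R base_polar q u) * inverse (q \<bullet> q) ^ 6
      - 12 * icosahedral_sextic (base q) * (q \<bullet> u) * inverse (q \<bullet> q) ^ 7)"

lemma radial_extension_seed:
  assumes "q \<noteq> 0"
  shows "radial_extension (lift I F) q = \<alpha> * (icosahedral_sextic (base q) * inverse (q \<bullet> q) ^ 6) + \<beta>"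
proof -
  have "q /\<^sub>R norm q \<in> S3" using assms by simp
  then have "radial_extension (lift I F) q = \<alpha> * icosahedral_sextic (base (q /\<^sub>R norm q)) + \<beta>"
    unfolding radial_extension_def lift_def by (rule F)
  moreover have "(inverse (norm q))^2 = inverse (q \<bullet> q)"
    by (simp add: power_inverse power2_norm_eq_inner)
  ultimately show ?thesis by (simp add: base_scaleR icosahedral_sextic_scaleR)
qed

lemma radial_extension_has_derivative:
  assumes q: "q \<noteq> 0"
  shows "(radial_extension (lift I F) has_derivative seed_differential q) (at q)"
proof (rule has_derivative_transform_within_open)
  show "((\<lambda>q. \<alpha> * (icosahedral_sextic (base q) * inverse (q \<bullet> q) ^ 6) + \<beta>) has_derivative seed_differential q) (at q)"
    by (rule derivative_eq_intros has_derivative_icosahedral_sextic has_derivative_base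
        has_derivative_inverse_inner[OF q] refl)+
      (simp add: seed_differential_def fun_eq_iff algebra_simps power_numeral_reduce)
  show "open (- {0::complex^2})" by auto
qed (use q radial_extension_seed in auto)

lemma frechet_derivative_seed:
  "q \<noteq> 0 \<Longrightarrow> frechet_derivative (radial_extension (lift I F)) (at q) = seed_differential q"
  using frechet_derivative_at[OF radial_extension_has_derivative] by simp

lemma sphere_differential_seed:
  assumes p: "norm p = 1" "p \<bullet> v = 0"
  shows "sphere_differential (lift I F) p v = \<alpha> * sextic_deriv (base p) (2 *\<^sub>R base_polar p v)"
proof -
  have "p \<noteq> 0" "p \<bullet> p = 1" using p by (auto simp: norm_eq_1)
  then show ?thesis using p
    by (simp add: sphere_differential_def frechet_derivative_seed seed_differential_def)
qed

text \<open>The differential of \<^const>\<open>base\<close> maps the tangent space of \<open>S\<^sup>3\<close> onto that of \<open>S\<^sup>2\<close>.\<close>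

lemma critical_iff:
  assumes p: "norm p = 1"
  shows "(\<forall>v\<in>sphere_tangent_space p. sphere_differential (lift I F) p v = 0)
     \<longleftrightarrow> tangentially_critical (base p)"
proof
  assume *: "\<forall>v\<in>sphere_tangent_space p. sphere_differential (lift I F) p v = 0"
  show "tangentially_critical (base p)" unfolding tangentially_critical_def
  proof (intro allI impI)
    fix x assume "base p \<bullet> x = 0"
    then obtain v where "p \<bullet> v = 0" "2 *\<^sub>R base_polar p v = x" by (rule tangent_lift[OF p])
    then show "sextic_deriv (base p) x = 0"
      using * sphere_differential_seed[OF p, of v] \<alpha> by (simp add: sphere_tangent_space_def)
  qed
next
  assume "tangentially_critical (base p)"
  then show "\<forall>v\<in>sphere_tangent_space p. sphere_differential (lift I F) p v = 0"
    using p by (simp add: sphere_tangent_space_def sphere_differential_seed tangentially_critical_def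
        inner_base_base_polar)
qed

text \<open>Besides the pullback of \<open>D\<^sup>2G\<close> the chain rule produces a term with the second derivative of
  \<^const>\<open>base\<close> and the radial extension one with \<open>12 G (u \<bullet> v)\<close>. At a critical point the differential of
  \<open>G\<close> is \<open>6 G (x \<bullet> w)\<close>, and \<open>base_polar_gauss\<close> combines the two terms into the pullback of
  \<open>- 6 G (u \<bullet> v)\<close>.\<close>

lemma sphere_hessian_seed:
  assumes p: "norm p = 1" and crit: "tangentially_critical (base p)"
    and u: "p \<bullet> u = 0" and v: "p \<bullet> v = 0"
  shows "sphere_hessian (lift I F) p u v = \<alpha> *
     (sextic_deriv2 (base p) (2 *\<^sub>R base_polar p u) (2 *\<^sub>R base_polar p v)
      - 6 * icosahedral_sextic (base p) * ((2 *\<^sub>R base_polar p u) \<bullet> (2 *\<^sub>R base_polar p v)))"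
proof -
  let ?x = "base p"
  have p0: "p \<noteq> 0" and pp: "p \<bullet> p = 1" using p by (auto simp: norm_eq_1)
  have xx: "?x \<bullet> ?x = 1" using norm_base[of p] p by (simp add: norm_eq_1)
  have euler: "sextic_deriv ?x w = 6 * icosahedral_sextic ?x * (?x \<bullet> w)" for w
  proof -
    interpret bounded_linear "sextic_deriv ?x" by (rule bounded_linear_sextic_deriv)
    have "?x \<bullet> (w - (?x \<bullet> w) *\<^sub>R ?x) = 0" using xx by (simp add: inner_diff_right)
    then have "sextic_deriv ?x (w - (?x \<bullet> w) *\<^sub>R ?x) = 0"
      using crit by (simp add: tangentially_critical_def)
    then show ?thesis by (simp add: diff scaleR sextic_deriv_self)
  qed
  \<comment> \<open>The derivative is taken in all directions \<open>v\<close>, tangent or not; most terms vanish later for tangent \<open>u\<close> and \<open>v\<close>.\<close>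
  let ?D = "\<lambda>v. \<alpha> * (
      (sextic_deriv2 ?x (2 *\<^sub>R base_polar p u) (2 *\<^sub>R base_polar p v) + sextic_deriv ?x (2 *\<^sub>R base_polar v u))
        - 12 * (p \<bullet> v) * sextic_deriv ?x (2 *\<^sub>R base_polar p u)
      - 12 * (sextic_deriv ?x (2 *\<^sub>R base_polar p v) * (p \<bullet> u) + icosahedral_sextic ?x * (v \<bullet> u)
         - 14 * icosahedral_sextic ?x * (p \<bullet> u) * (p \<bullet> v)))"
  have "((\<lambda>q. seed_differential q u) has_derivative ?D) (at p)"
    unfolding seed_differential_def
    by (rule derivative_eq_intros has_derivative_icosahedral_sextic has_derivative_sextic_deriv
        has_derivative_base has_derivative_inverse_inner[OF p0]
        bounded_bilinear.FDERIV[OF bounded_bilinear_base_polar] refl)+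
      (simp add: pp fun_eq_iff algebra_simps bounded_bilinear.zero_right[OF bounded_bilinear_base_polar])
  then have D: "((\<lambda>q. frechet_derivative (radial_extension (lift I F)) (at q) u) has_derivative ?D) (at p)"
  proof (rule has_derivative_transform_within_open)
    show "open (- {0::complex^2})" by auto
  qed (use p0 in \<open>auto simp: frechet_derivative_seed\<close>)
  have "sphere_hessian (lift I F) p u v = ?D v"
    unfolding sphere_hessian_def second_derivative_def
    by (rule fun_cong[OF frechet_derivative_at[OF D, symmetric]])
  moreover have "?x \<bullet> base_polar v u = u \<bullet> v - 2 * (base_polar p u \<bullet> base_polar p v)"
    using base_polar_gauss[of p u v] u v pp by (simp add: base_polar_commute[of v u])
  ultimately show ?thesis using u v
    by (simp add: euler inner_base_base_polar inner_commute algebra_simps)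
qed

lemma hessian_kernel_seed:
  assumes p: "norm p = 1" and crit: "tangentially_critical (base p)"
    and nondeg: "nondegenerate_direction (base p)"
  shows "hessian_kernel (lift I F) p = {t *\<^sub>R (\<i> *s p) | t. True}"
proof (intro equalityI subsetI)
  have xx: "base p \<bullet> base p = 1" using norm_base[of p] p by (simp add: norm_eq_1)
  fix u assume "u \<in> hessian_kernel (lift I F) p"
  then have u: "p \<bullet> u = 0" and h: "\<And>v. p \<bullet> v = 0 \<Longrightarrow> sphere_hessian (lift I F) p u v = 0"
    by (auto simp: hessian_kernel_def sphere_tangent_space_def)
  have "2 *\<^sub>R base_polar p u = 0"
  proof (rule nondeg[unfolded nondegenerate_direction_def, rule_format])
    show "base p \<bullet> 2 *\<^sub>R base_polar p u = 0" by (simp add: inner_base_base_polar u)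
    fix w assume "base p \<bullet> w = 0"
    then obtain v where "p \<bullet> v = 0" "2 *\<^sub>R base_polar p v = w" by (rule tangent_lift[OF p])
    then show "(base p \<bullet> base p) * sextic_deriv2 (base p) (2 *\<^sub>R base_polar p u) w
        = 6 * icosahedral_sextic (base p) * (2 *\<^sub>R base_polar p u \<bullet> w)"
      using h[of v] sphere_hessian_seed[OF p crit u, of v] \<alpha> by (simp add: xx)
  qed
  then have "S *v hopf_polar p u = S *v 0" by (simp add: base_polar_def)
  then have "hopf_polar p u = 0" using SO3_inj[OF S] by blast
  then show "u \<in> {t *\<^sub>R (\<i> *s p) | t. True}" using hopf_polar_eq_0[OF p] by blast
next
  fix u assume "u \<in> {t *\<^sub>R (\<i> *s p) | t. True}"
  then obtain t where u: "u = t *\<^sub>R (\<i> *s p)" by blast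
  have "base_polar p u = 0"
    by (simp add: u base_polar_def bounded_bilinear.scaleR_right[OF bounded_bilinear_hopf_polar] hopf_polar_vertical)
  moreover have "p \<bullet> u = 0" by (simp add: u inner_vertical)
  moreover have "sextic_deriv2 (base p) 0 w = 0" for w
    using bounded_linear.linear[OF bounded_linear_sextic_deriv2] sextic_deriv2_commute by (metis linear_0)
  ultimately show "u \<in> hessian_kernel (lift I F) p"
    using sphere_hessian_seed[OF p crit] by (simp add: hessian_kernel_def sphere_tangent_space_def)
qed

end

section \<open>The exceptional fibers\<close>

lemma cis_eq_1_iff: "cis x = 1 \<longleftrightarrow> (\<exists>k::int. x = 2 * pi * of_int k)"
proof -
  have "cis x = 1 \<longleftrightarrow> cos x = 1"
    by (auto simp: complex_eq_iff cos_one_sin_zero)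
  also have "\<dots> \<longleftrightarrow> (\<exists>k::int. x = 2 * pi * of_int k)"
    by (simp add: cos_one_2pi_int algebra_simps)
  finally show ?thesis .
qed

lemma bounded_linear_smult_vector: "bounded_linear (\<lambda>z::complex. z *s p)" for p :: "complex^2"
  unfolding linear_conv_bounded_linear[symmetric]
  by (auto intro!: linearI simp: vec_eq_2 algebra_simps)

lemma has_vector_derivative_cis_smult:
  "((\<lambda>t. (w * cis (r * t)) *s p) has_vector_derivative (w * (of_real r * \<i>) * cis (r * t)) *s p) (at t)"
  for p :: "complex^2"
proof (rule bounded_linear.has_vector_derivative[OF bounded_linear_smult_vector])
  show "((\<lambda>t. w * cis (r * t)) has_vector_derivative w * (of_real r * \<i>) * cis (r * t)) (at t)"
    unfolding cis_conv_exp of_real_mult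
    by (rule has_vector_derivative_real_field) (auto intro!: derivative_eq_intros)
qed

text \<open>The representative whose isotropy group has order \<open>m\<close>, for \<open>m\<close> equal to 5, 3 or 2.\<close>

definition special_point :: "nat \<Rightarrow> real^3" where
  "special_point m = (if m = 5 then vertex_direction else if m = 3 then face_direction else edge_direction)"

lemma special_point_cases:
  "m \<in> {5, 3, 2} \<Longrightarrow> special_point m \<in> {edge_direction, face_direction, vertex_direction}"
  by (auto simp: special_point_def)

lemma card_stabilizer_special_point: "m \<in> {5, 3, 2} \<Longrightarrow> card (stabilizer (special_point m)) = m"
  by (auto simp: special_point_def card_stabilizer_edge card_stabilizer_face card_stabilizer_vertex)

context lifted_seed
begin

lemma order_critical:
  assumes "card (stabilizer x) > 1" shows "tangentially_critical x"
proof -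
  have "\<not> stabilizer x \<subseteq> {mat 1}" using assms card_mono[of "{mat 1}" "stabilizer x"] by auto
  then obtain R where R: "R \<in> icosahedral_rotations" "R *v x = x" "R \<noteq> mat 1"
    by (auto simp: stabilizer_def)
  show ?thesis
    using R by (intro fixed_point_tangentially_critical[of R]) (simp_all add: icosahedral_SO3 invariant)
qed

lemma critical_proportional:
  assumes "tangentially_critical x" "x \<noteq> 0"
  shows "\<exists>m\<in>{5, 3, 2}. ico_proportional x (special_point m)"
proof -
  obtain e where "e \<in> {edge_direction, face_direction, vertex_direction}" "ico_proportional x e"
    using tangentially_critical_special_direction assms by (auto simp: special_direction_def)
  then show ?thesis by (auto simp: special_point_def)
qed

text \<open>Nontrivial isotropy makes \<open>x\<close> critical, hence of one of the three kinds, and the order tells which.\<close>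

lemma order_proportional:
  assumes m: "m \<in> {5, 3, 2}" and x: "card (stabilizer x) = m" "x \<noteq> 0"
  shows "ico_proportional x (special_point m)"
proof -
  have "tangentially_critical x" using m x by (intro order_critical) auto
  then obtain n where n: "n \<in> {5, 3, 2}" "ico_proportional x (special_point n)"
    using critical_proportional x by blast
  then have "n = m" using card_stabilizer_proportional card_stabilizer_special_point x by metis
  with n show ?thesis by simp
qed

lemma base_nonzero: "p \<in> S3 \<Longrightarrow> base p \<noteq> 0"
  using norm_base[of p] by auto

lemma card_stabilizer_I:
  assumes "A \<in> I" shows "card (stabilizer (base (A *v p))) = card (stabilizer (base p))"
proof -
  obtain R where R: "R \<in> icosahedral_rotations" "base (A *v p) = R *v base p"
    using I_base[OF assms] by metis
  then have "ico_proportional (base p) (base (A *v p))"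
    by (intro ico_proportionalI[of R 1]) simp_all
  then show ?thesis by (simp add: card_stabilizer_proportional)
qed

lemma orbit_in_exceptional_fiber:
  assumes "p \<in> S3"
  shows "orbit I p \<in> exceptional_fiber I m \<longleftrightarrow> card (stabilizer (base p)) = m"
proof
  assume "orbit I p \<in> exceptional_fiber I m"
  then obtain q where "orbit I p = orbit I q" "card (stabilizer (base q)) = m"
    by (auto simp: exceptional_fiber_def orbifold_order_hopf)
  then show "card (stabilizer (base p)) = m" using card_stabilizer_I orbit_eq_iff by metis
qed (use assms in \<open>auto simp: exceptional_fiber_def orbifold_order_hopf\<close>)

lemma orbit_in_critical_points:
  assumes p: "p \<in> S3"
  shows "orbit I p \<in> critical_points I F \<longleftrightarrow> card (stabilizer (base p)) \<in> {5, 3, 2}"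
proof
  assume "orbit I p \<in> critical_points I F"
  moreover have "p \<in> orbit I p" using I_mat_1 by (force simp: orbit_def)
  ultimately have "tangentially_critical (base p)"
    using critical_iff[of p] p by (auto simp: critical_points_def)
  then obtain m where "m \<in> {5, 3, 2}" "ico_proportional (base p) (special_point m)"
    using critical_proportional base_nonzero p by blast
  then show "card (stabilizer (base p)) \<in> {5, 3, 2}"
    using card_stabilizer_proportional card_stabilizer_special_point by metis
next
  assume m: "card (stabilizer (base p)) \<in> {5, 3, 2}"
  have "\<forall>v\<in>sphere_tangent_space q. sphere_differential (lift I F) q v = 0" if q: "q \<in> orbit I p" for q
  proof -
    obtain A where A: "A \<in> I" "q = A *v p" using q by (auto simp: orbit_def)
    have "tangentially_critical (base q)"
      unfolding A(2) using m card_stabilizer_I[OF A(1)] by (intro order_critical) auto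
    moreover have "norm q = 1" using p A by (simp add: SU2_norm I_SU2)
    ultimately show ?thesis by (simp add: critical_iff)
  qed
  then show "orbit I p \<in> critical_points I F" using p by (auto simp: critical_points_def space_form_def)
qed

lemma exceptional_fiber_orbit:
  "X \<in> exceptional_fiber I m \<Longrightarrow> \<exists>p\<in>S3. X = orbit I p \<and> card (stabilizer (base p)) = m"
  by (auto simp: exceptional_fiber_def orbifold_order_hopf)

lemma critical_points_eq:
  "critical_points I F = exceptional_fiber I 5 \<union> exceptional_fiber I 3 \<union> exceptional_fiber I 2"
proof (intro equalityI subsetI)
  fix X assume X: "X \<in> critical_points I F"
  then obtain p where p: "p \<in> S3" "X = orbit I p" by (auto simp: critical_points_def space_form_def)
  then show "X \<in> exceptional_fiber I 5 \<union> exceptional_fiber I 3 \<union> exceptional_fiber I 2"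
    using X orbit_in_critical_points orbit_in_exceptional_fiber by auto
next
  fix X assume "X \<in> exceptional_fiber I 5 \<union> exceptional_fiber I 3 \<union> exceptional_fiber I 2"
  then obtain p where "p \<in> S3" "X = orbit I p" "card (stabilizer (base p)) \<in> {5, 3, 2}"
    using exceptional_fiber_orbit by blast
  then show "X \<in> critical_points I F" using orbit_in_critical_points by simp
qed

lemma exceptional_fibers_disjoint:
  "m \<noteq> n \<Longrightarrow> exceptional_fiber I m \<inter> exceptional_fiber I n = {}"
  using exceptional_fiber_orbit orbit_in_exceptional_fiber by fastforce

lemma base_smult: "cmod z = 1 \<Longrightarrow> base (z *s p) = base p"
  by (simp add: base_def hopf_smult)

lemma base_surj: "\<exists>p. base p = x"
proof -
  obtain p where "hopf p = transpose S *v x" using hopf_surj by blast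
  then show ?thesis by (intro exI[of _ p]) (simp add: base_def SO3_transpose_mult[OF S])
qed

text \<open>The curve is \<open>e\<^bsup>it\<^esup> p\<close> with \<open>p\<close> over a representative of order \<open>m\<close>. It returns to its orbit when
  \<open>e\<^bsup>it\<^esup>\<close> is a \<open>2m\<close>-th root of unity, hence the period. All points of the fiber are reached because points
  of \<open>S\<^sup>2\<close> of order \<open>m\<close> form a single orbit and Hopf fibers are circles of scalars.\<close>

lemma exceptional_fiber_circle:
  assumes m: "m \<in> {5, 3, 2}"
  shows "embedded_circle I (exceptional_fiber I m)"
proof -
  let ?e = "special_point m"
  have e0: "?e \<noteq> 0" using special_point_cases[OF m] by (auto simp: direction_defs vec_eq_3)
  obtain p where p: "base p = ?e /\<^sub>R norm ?e" using base_surj by blast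
  have "norm p ^ 2 = 1" using norm_base[of p] e0 by (simp add: p)
  then have np: "norm p = 1" by (metis abs_norm_cancel abs_1 power2_eq_1_iff abs_minus_cancel)
  have pe: "ico_proportional (base p) ?e"
    using e0 by (intro ico_proportionalI[of "mat 1" "inverse (norm ?e)"]) (simp_all add: icosahedral_mat_1 p)
  have cp: "card (stabilizer (base p)) = m"
    using card_stabilizer_proportional[OF pe] card_stabilizer_special_point[OF m] by simp
  have m0: "m > 0" using m by auto
  define g where "g n t = (\<i> ^ n * cis t) *s p" for n t
  have g0: "g 0 t = cis t *s p" for t by (simp add: g_def)
  have gS: "g 0 t \<in> S3" for t by (simp add: g0 norm_vector_smult np)
  have base_g: "base (g 0 t) = base p" for t by (simp add: g0 base_smult)
  have orbits: "orbit I (g 0 s) = orbit I (g 0 t) \<longleftrightarrow> (\<exists>k::int. t = s + of_int k * (pi / m))" for s t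
  proof -
    have "orbit I (g 0 s) = orbit I (g 0 t) \<longleftrightarrow> (\<exists>A\<in>I. A *v p = cis (t - s) *s p)"
    proof -
      have "cis t *s p = A *v (cis s *s p) \<longleftrightarrow> A *v p = cis (t - s) *s p" for A
      proof -
        have "cis s *s (cis (t - s) *s p) = cis t *s p" by (simp add: vec_eq_2 cis_mult mult.assoc[symmetric])
        moreover have "cis (- s) *s (cis s *s q) = q" for q :: "complex^2"
          by (simp add: vec_eq_2 cis_mult mult.assoc[symmetric])
        ultimately show ?thesis by (metis SU2_smult)
      qed
      then show ?thesis by (simp add: orbit_eq_iff g0)
    qed
    also have "\<dots> \<longleftrightarrow> cis (t - s) ^ (2 * m) = 1" by (rule fiber_rotations[OF np cp m0])
    also have "\<dots> \<longleftrightarrow> (\<exists>k::int. real (2 * m) * (t - s) = 2 * pi * of_int k)"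
      by (simp only: Complex.DeMoivre cis_eq_1_iff)
    also have "\<dots> \<longleftrightarrow> (\<exists>k::int. t = s + of_int k * (pi / m))"
    proof -
      have "real (2 * m) * (t - s) = 2 * pi * of_int k \<longleftrightarrow> real m * (t - s) = pi * of_int k" for k :: int
        by simp
      also have "\<dots> k \<longleftrightarrow> t = s + of_int k * (pi / m)" for k :: int
        using m0 by (simp add: field_simps)
      finally show ?thesis by simp
    qed
    finally show ?thesis .
  qed
  have img: "exceptional_fiber I m = range (\<lambda>t. orbit I (g 0 t))"
  proof (intro equalityI subsetI)
    fix X assume "X \<in> exceptional_fiber I m"
    then obtain q where q: "q \<in> S3" "X = orbit I q" "card (stabilizer (base q)) = m"
      using exceptional_fiber_orbit by blast
    have "ico_proportional (base q) ?e" using order_proportional[OF m q(3)] base_nonzero q by blast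
    moreover have "norm (base p) = norm (base q)" using q np by (simp add: norm_base)
    ultimately obtain R where R: "R \<in> icosahedral_rotations" "base q = R *v base p"
      using proportional_unit_vectors[OF special_point_cases[OF m] pe] by blast
    obtain A where A: "A \<in> I" "base (A *v p) = R *v base p" using covered_rotation[OF R(1)] by metis
    have "hopf (A *v p) = hopf q" using A R base_eq_iff by metis
    then obtain z where z: "cmod z = 1" "q = z *s (A *v p)"
      using hopf_fiber[of "A *v p" q] SU2_norm[OF I_SU2[OF A(1)]] np q by auto
    obtain t where t: "z = cis t" using z(1) by (metis cis_Arg norm_eq_zero sgn_eq div_by_1 of_real_1 zero_neq_one)
    have "q = A *v g 0 t" by (simp add: z t g0 SU2_smult)
    then have "X = orbit I (g 0 t)" using orbit_eq_iff A q by metis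
    then show "X \<in> range (\<lambda>t. orbit I (g 0 t))" by blast
  next
    fix X assume "X \<in> range (\<lambda>t. orbit I (g 0 t))"
    then show "X \<in> exceptional_fiber I m"
      using orbit_in_exceptional_fiber[OF gS] base_g cp by auto
  qed
  have "(g n has_vector_derivative g (Suc n) t) (at t)" for n t
    using has_vector_derivative_cis_smult[of "\<i> ^ n" 1 p t] by (simp add: g_def[abs_def] mult.commute)
  moreover have "g 1 t \<noteq> 0" for t
  proof -
    have "norm (g 1 t) = 1" by (simp add: g_def norm_vector_smult norm_mult np)
    then show ?thesis by auto
  qed
  ultimately show ?thesis unfolding embedded_circle_def
    using gS orbits img m0 by (intro exI[of _ g] exI[of _ "pi / m"]) simp
qed

end

context lifted_seed
begin

lemma exceptional_base_finite:
  assumes m: "m \<in> {5, 3, 2}"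
  shows "finite {y. norm y = 1 \<and> card (stabilizer y) = m}"
proof (cases "{y. norm y = 1 \<and> card (stabilizer y) = m} = {}")
  case False
  then obtain x where x: "norm x = 1" "card (stabilizer x) = m" by blast
  have "{y. norm y = 1 \<and> card (stabilizer y) = m} \<subseteq> (\<lambda>R. R *v x) ` icosahedral_rotations"
  proof
    fix y assume "y \<in> {y. norm y = 1 \<and> card (stabilizer y) = m}"
    then have y: "norm y = 1" "card (stabilizer y) = m" by auto
    have "x \<noteq> 0" "y \<noteq> 0" using x y by auto
    then have "ico_proportional x (special_point m)" "ico_proportional y (special_point m)"
      using x y order_proportional[OF m] by blast+
    then show "y \<in> (\<lambda>R. R *v x) ` icosahedral_rotations"
      using proportional_unit_vectors[OF special_point_cases[OF m]] x y by fastforce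
  qed
  then show ?thesis using finite_icosahedral_rotations finite_surj by blast
qed (simp only: finite.emptyI)

text \<open>A curve over the exceptional fiber projects to a finite subset of \<open>S\<^sup>2\<close>. It is continuous at time 0,
  so its projection is constant near 0, and its velocity is vertical.\<close>

lemma lifted_tangent_space_exceptional_fiber:
  assumes m: "m \<in> {5, 3, 2}" and p: "p \<in> S3" and cp: "card (stabilizer (base p)) = m"
  shows "lifted_tangent_space I (exceptional_fiber I m) p = {t *\<^sub>R (\<i> *s p) | t. True}"
proof (intro equalityI subsetI)
  fix v assume "v \<in> {t *\<^sub>R (\<i> *s p) | t. True}"
  then obtain r where v: "v = r *\<^sub>R (\<i> *s p)" by blast
  define c where "c t = cis (r * t) *s p" for t
  have "c 0 = p" by (simp add: c_def)
  moreover have cS: "c t \<in> S3" for t using p by (simp add: c_def norm_vector_smult)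
  moreover have "orbit I (c t) \<in> exceptional_fiber I m" for t
    using orbit_in_exceptional_fiber[OF cS] cp by (simp add: c_def base_smult)
  moreover have "(c has_vector_derivative v) (at 0)"
  proof -
    have "(of_real r * \<i>) *s p = v" 
      unfolding v vec_eq_2 vector_smult_component vector_scaleR_component
      by (simp add: scaleR_conv_of_real)
    then show ?thesis
      using has_vector_derivative_cis_smult[of 1 r p 0] by (simp add: c_def[abs_def])
  qed
  ultimately show "v \<in> lifted_tangent_space I (exceptional_fiber I m) p"
    unfolding lifted_tangent_space_def by blast
next
  fix v assume "v \<in> lifted_tangent_space I (exceptional_fiber I m) p"
  then obtain c where c: "c 0 = p" "\<And>t. c t \<in> S3" "\<And>t. orbit I (c t) \<in> exceptional_fiber I m"
    and d: "(c has_vector_derivative v) (at 0)"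
    unfolding lifted_tangent_space_def by blast
  let ?B = "{y. norm y = 1 \<and> card (stabilizer y) = m}"
  have B: "base (c t) \<in> ?B" for t
    using c(2,3) orbit_in_exceptional_fiber by (simp add: norm_base)
  have "open (- (?B - {base p}))"
    using exceptional_base_finite[OF m] by (intro open_Compl finite_imp_closed) auto
  have D: "((\<lambda>t. base (c t)) has_derivative (\<lambda>t. 2 *\<^sub>R base_polar p (t *\<^sub>R v))) (at 0)"
  proof -
    have "(c has_derivative (\<lambda>t. t *\<^sub>R v)) (at 0)" using d by (simp add: has_vector_derivative_def)
    from diff_chain_at[OF this, of base] show ?thesis
      using has_derivative_base[of p] by (simp add: c(1) o_def)
  qed
  then have "isCont (\<lambda>t. base (c t)) 0" by (rule has_derivative_continuous)
  then have "((\<lambda>t. base (c t)) \<longlongrightarrow> base p) (at 0)" by (simp add: isCont_def c(1))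
  then have "eventually (\<lambda>t. base (c t) \<in> - (?B - {base p})) (at 0)"
    by (rule topological_tendstoD[OF _ \<open>open _\<close>]) simp
  then have ev: "eventually (\<lambda>t. base (c t) = base p) (at 0)"
    by (rule eventually_mono) (use B in blast)
  have "((\<lambda>t. base p) has_derivative (\<lambda>t. 2 *\<^sub>R base_polar p (t *\<^sub>R v))) (at 0)"
    by (rule has_derivative_transform_eventually[OF D ev]) (simp_all add: c(1))
  then have "(\<lambda>t. 2 *\<^sub>R base_polar p (t *\<^sub>R v)) = (\<lambda>t. 0)"
    using has_derivative_const has_derivative_unique by blast
  from fun_cong[OF this, of 1] have "S *v hopf_polar p v = S *v 0" by (simp add: base_polar_def)
  then have "hopf_polar p v = 0" using SO3_inj[OF S] by blast
  then show "v \<in> {t *\<^sub>R (\<i> *s p) | t. True}" using hopf_polar_eq_0[of p v] p by auto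
qed

lemma morse_bott_exceptional_fiber:
  assumes m: "m \<in> {5, 3, 2}"
  shows "morse_bott_along I F (exceptional_fiber I m)"
  unfolding morse_bott_along_def
proof (intro conjI ballI impI)
  show "exceptional_fiber I m \<subseteq> critical_points I F" using m critical_points_eq by auto
  fix p assume p: "p \<in> S3" "orbit I p \<in> exceptional_fiber I m"
  then have cp: "card (stabilizer (base p)) = m" by (simp add: orbit_in_exceptional_fiber)
  have "nondegenerate_direction (special_point m)"
    by (simp add: special_point_def nondegenerate_edge nondegenerate_face nondegenerate_vertex)
  then have "nondegenerate_direction (base p)"
    using nondegenerate_direction_proportional invariant order_proportional[OF m cp] base_nonzero[OF p(1)]
    by blast
  moreover have "tangentially_critical (base p)" using cp m by (intro order_critical) auto
  ultimately show "hessian_kernel (lift I F) p = lifted_tangent_space I (exceptional_fiber I m) p"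
    using hessian_kernel_seed[of p] lifted_tangent_space_exceptional_fiber[OF m p(1) cp] p(1) by simp
qed

end

section \<open>The form of the seed\<close>

text \<open>Only that the value is a nonzero multiple of \<open>a\<close> matters: it excludes \<open>\<bar>x\<bar>\<^sup>6\<close> as the harmonic
  form.\<close>

lemma laplacian_norm_power6:
  assumes x: "norm x = 1"
  shows "laplacian (\<lambda>y :: real^3. a * norm y ^ 6) x = 42 * a"
proof -
  have xx: "x \<bullet> x = 1" using x by (simp add: norm_eq_1)
  have n: "norm y ^ 6 = (y \<bullet> y) ^ 3" for y :: "real^3"
  proof -
    have "norm y ^ 6 = (norm y ^ 2) ^ 3" by simp
    then show ?thesis by (simp only: power2_norm_eq_inner)
  qed
  have d: "frechet_derivative (\<lambda>y :: real^3. a * (y \<bullet> y) ^ 3) (at y) u = 6 * a * (y \<bullet> y) ^ 2 * (y \<bullet> u)" for y u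
  proof -
    have "((\<lambda>y :: real^3. a * (y \<bullet> y) ^ 3) has_derivative (\<lambda>u. 6 * a * (y \<bullet> y) ^ 2 * (y \<bullet> u))) (at y)"
      by (auto intro!: derivative_eq_intros simp: fun_eq_iff inner_commute)
    from fun_cong[OF frechet_derivative_at[OF this, symmetric]] show ?thesis .
  qed
  have "second_derivative (\<lambda>y :: real^3. a * (y \<bullet> y) ^ 3) x b b = 24 * a * (x \<bullet> b)^2 + 6 * a * (b \<bullet> b)" for b
  proof -
    have "((\<lambda>y :: real^3. 6 * a * (y \<bullet> y) ^ 2 * (y \<bullet> b)) has_derivative
        (\<lambda>v. 24 * a * (x \<bullet> b) * (x \<bullet> v) + 6 * a * (v \<bullet> b))) (at x)"
      by (rule derivative_eq_intros refl)+
        (simp add: fun_eq_iff xx inner_commute)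
    from fun_cong[OF frechet_derivative_at[OF this, symmetric]] show ?thesis
      unfolding second_derivative_def d by (simp add: power2_eq_square)
  qed
  then have "laplacian (\<lambda>y :: real^3. a * norm y ^ 6) x
      = 24 * a * (\<Sum>b\<in>Basis. (x \<bullet> b) * (x \<bullet> b)) + 6 * a * (\<Sum>b\<in>(Basis :: (real^3) set). b \<bullet> b)"
    unfolding laplacian_def n by (simp add: sum.distrib sum_distrib_left power2_eq_square)
  also have "(\<Sum>b\<in>(Basis :: (real^3) set). b \<bullet> b) = 3" by simp
  also have "(\<Sum>b\<in>Basis. (x \<bullet> b) * (x \<bullet> b)) = 1"
    using xx euclidean_inner[of x x] by simp
  finally show ?thesis by simp
qed

lemma rotated_icosahedron_conjugate:
  assumes T: "covers U T" and I: "I = (\<lambda>A. U ** A ** conj_transpose U) ` standard_binary_icosahedral"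
  shows "rotated_icosahedron (transpose T) I"
proof
  have U: "U \<in> SU2" and T': "T \<in> SO3" using T by (auto simp: covers_def)
  show "transpose T \<in> SO3" using T' by (rule SO3_transpose)
  fix A
  have "A \<in> I \<longleftrightarrow> (\<exists>R. covers A R \<and> transpose T ** R ** T \<in> icosahedral_rotations)"
  proof
    assume "A \<in> I"
    then obtain B R where B: "A = U ** B ** conj_transpose U" "R \<in> icosahedral_rotations" "covers B R"
      by (auto simp: I standard_binary_icosahedral_def)
    have "covers A (T ** R ** transpose T)"
      unfolding B(1) using T B(3) by (intro covers_mult covers_conj_transpose)
    then show "\<exists>R. covers A R \<and> transpose T ** R ** T \<in> icosahedral_rotations"
      using B(2) by (intro exI[of _ "T ** R ** transpose T"]) (simp add: SO3_conjugate(2)[OF T'])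
  next
    assume "\<exists>R. covers A R \<and> transpose T ** R ** T \<in> icosahedral_rotations"
    then obtain R where R: "covers A R" "transpose T ** R ** T \<in> icosahedral_rotations" by blast
    have "covers (conj_transpose U ** A ** U) (transpose T ** R ** T)"
      using T R(1) by (intro covers_mult covers_conj_transpose)
    then have "conj_transpose U ** A ** U \<in> standard_binary_icosahedral"
      using R(2) by (auto simp: standard_binary_icosahedral_def)
    moreover have "A = U ** (conj_transpose U ** A ** U) ** conj_transpose U"
      by (simp add: matrix_eq SU2_conj_transpose_mult[OF U] flip: matrix_vector_mul_assoc)
    ultimately show "A \<in> I" unfolding I by blast
  qed
  then show "A \<in> I \<longleftrightarrow> (\<exists>R. covers A R \<and> transpose T ** R ** transpose (transpose T) \<in> icosahedral_rotations)"
    by simp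
qed

text \<open>Invariance is assumed on the sphere, but the classification of invariant forms needs it on
  the whole space.\<close>

lemma homogeneous_invariant_from_sphere:
  assumes hom: "\<And>c x. P (c *\<^sub>R x) = c ^ n * (P x :: real)" and R: "R \<in> SO3"
    and inv: "\<And>x. norm x = 1 \<Longrightarrow> P (R *v x) = P x"
  shows "P (R *v x) = P x"
proof (cases "x = 0")
  case False
  define u where "u = x /\<^sub>R norm x"
  have u: "norm u = 1" "x = norm x *\<^sub>R u" using False by (simp_all add: u_def)
  have "P (R *v x) = norm x ^ n * P (R *v u)"
    using hom[of "norm x" "R *v u"] u(2) by (metis matrix_vector_mult_scaleR)
  also have "\<dots> = P x" using hom[of "norm x" u] u by (simp add: inv)
  finally show ?thesis .
qed simp

lemma (in rotated_icosahedron) seed_form: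
  assumes "invariant_seed I F"
  obtains \<alpha> \<beta> where "lifted_seed S I F \<alpha> \<beta>"
proof -
  obtain Y where Y: "spherical_harmonic 6 Y" and nz: "\<exists>x\<in>S2. Y x \<noteq> 0"
    and "\<forall>R\<in>rotation_image I. \<forall>x\<in>S2. Y (R *v x) = Y x" "\<forall>p\<in>S3. F (orbit I p) = Y (hopf p)"
    using assms unfolding invariant_seed_def by blast
  then have inv: "R \<in> rotation_image I \<Longrightarrow> x \<in> S2 \<Longrightarrow> Y (R *v x) = Y x"
    and FY: "p \<in> S3 \<Longrightarrow> F (orbit I p) = Y (hopf p)" for R x p
    by blast+
  obtain P where P: "real_polynomial_function P" and "\<forall>c x. P (c *\<^sub>R x) = c ^ 6 * P x"
    and "\<forall>x. laplacian P x = 0" "\<forall>x\<in>S2. Y x = P x"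
    using Y unfolding spherical_harmonic_def by blast
  then have hom: "P (c *\<^sub>R x) = c ^ 6 * P x" and lap: "laplacian P x = 0"
    and YP: "x \<in> S2 \<Longrightarrow> Y x = P x" for c x
    by blast+
  define Q where "Q x = P (transpose S *v x)" for x
  have Q: "real_polynomial_function Q"
  proof -
    have "polynomial_function (\<lambda>x. transpose S *v x)"
      by (intro polynomial_function_bounded_linear matrix_vector_mul_bounded_linear)
    then have "real_polynomial_function (P \<circ> (\<lambda>x. transpose S *v x))"
      using P by (rule real_polynomial_function_compose)
    then show ?thesis by (simp add: Q_def[abs_def] o_def)
  qed
  have Qhom: "Q (t *\<^sub>R x) = t ^ 6 * Q x" for t x
    by (simp add: Q_def matrix_vector_mult_scaleR hom)
  have Qinv: "Q (R *v x) = Q x" if R: "R \<in> icosahedral_rotations" for R x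
  proof (rule homogeneous_invariant_from_sphere[OF Qhom icosahedral_SO3[OF R]])
    fix y :: "real^3" assume y: "norm y = 1"
    obtain A where A: "A \<in> I" "covers A (transpose S ** R ** S)" using covered_rotation[OF R] by metis
    let ?y = "transpose S *v y"
    have "norm ?y = 1" using y by (simp add: SO3_norm SO3_transpose S)
    moreover have "transpose S ** R ** S \<in> rotation_image I" using A by (auto simp: rotation_image_def)
    moreover have "(transpose S ** R ** S) *v ?y = transpose S *v (R *v y)"
      by (simp add: SO3_transpose_mult[OF S] flip: matrix_vector_mul_assoc)
    moreover have "norm (transpose S *v (R *v y)) = 1"
      using y R by (simp add: SO3_norm SO3_transpose S icosahedral_SO3)
    ultimately have "Y (transpose S *v (R *v y)) = Y ?y" using inv[of "transpose S ** R ** S" ?y] by simp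
    then show "Q (R *v y) = Q y"
      using YP \<open>norm ?y = 1\<close> \<open>norm (transpose S *v (R *v y)) = 1\<close> by (simp add: Q_def)
  qed
  obtain a \<alpha> where form: "\<And>x. Q x = a * norm x ^ 6 + \<alpha> * icosahedral_sextic x"
    using invariant_sextic[OF Q Qhom Qinv] by metis
  have Pform: "P x = a * norm x ^ 6 + \<alpha> * icosahedral_sextic (S *v x)" for x
    using form[of "S *v x"] by (simp add: Q_def SO3_transpose_mult[OF S] SO3_norm[OF S])
  have "\<alpha> \<noteq> 0"
  proof
    assume 0: "\<alpha> = 0"
    obtain x where x: "x \<in> S2" "Y x \<noteq> 0" using nz by blast
    have "P = (\<lambda>y. a * norm y ^ 6)" using Pform by (simp add: 0 fun_eq_iff)
    then have "42 * a = 0" using lap[of x] laplacian_norm_power6[of x a] x by simp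
    then show False using x YP Pform 0 by simp
  qed
  have "lifted_seed S I F \<alpha> a"
  proof (unfold_locales)
    show "\<alpha> \<noteq> 0" by fact
    show "F (orbit I p) = \<alpha> * icosahedral_sextic (base p) + a" if "p \<in> S3" for p
      using that FY YP Pform[of "hopf p"] by (simp add: norm_hopf base_def)
    show "icosahedral_sextic (R *v x) = icosahedral_sextic x" if R: "R \<in> icosahedral_rotations" for R x
      using Qinv[OF R, of x] form \<open>\<alpha> \<noteq> 0\<close> by (simp add: SO3_norm[OF icosahedral_SO3[OF R]])
  qed
  then show thesis by (rule that)
qed

theorem corollary6p3:
  fixes I :: "(complex^2^2) set" and F\<^sub>0 :: "(complex^2) set \<Rightarrow> real"
  assumes "binary_icosahedral I"
    and "invariant_seed I F\<^sub>0"
  shows "critical_points I F\<^sub>0 =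
           exceptional_fiber I 5 \<union> exceptional_fiber I 3 \<union> exceptional_fiber I 2
       \<and> exceptional_fiber I 5 \<inter> exceptional_fiber I 3 = {}
       \<and> exceptional_fiber I 5 \<inter> exceptional_fiber I 2 = {}
       \<and> exceptional_fiber I 3 \<inter> exceptional_fiber I 2 = {}
       \<and> (\<forall>m\<in>{5, 3, 2}. embedded_circle I (exceptional_fiber I m)
                        \<and> morse_bott_along I F\<^sub>0 (exceptional_fiber I m))"
proof -
  obtain U where U: "U \<in> SU2" "I = (\<lambda>A. U ** A ** conj_transpose U) ` standard_binary_icosahedral"
    using assms(1) by (auto simp: binary_icosahedral_def)
  obtain T where "covers U T" using U(1) by (rule SU2_covers)
  then interpret rotated_icosahedron "transpose T" I using U(2) by (rule rotated_icosahedron_conjugate)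
  obtain \<alpha> \<beta> where "lifted_seed (transpose T) I F\<^sub>0 \<alpha> \<beta>" using assms(2) by (rule seed_form)
  then interpret lifted_seed "transpose T" I F\<^sub>0 \<alpha> \<beta> .
  show ?thesis
  proof (intro conjI ballI)
    show "critical_points I F\<^sub>0 =
        exceptional_fiber I 5 \<union> exceptional_fiber I 3 \<union> exceptional_fiber I 2"
      by (rule critical_points_eq)
    fix m :: nat assume m: "m \<in> {5, 3, 2}"
    show "embedded_circle I (exceptional_fiber I m)" using m by (rule exceptional_fiber_circle)
    show "morse_bott_along I F\<^sub>0 (exceptional_fiber I m)" using m by (rule morse_bott_exceptional_fiber)
  qed (rule exceptional_fibers_disjoint; simp)+
qed

end
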